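(* Let $K$ be a knot in $\mathbb{S}^3$ with bridge index less than $4$, given by a diagram $D_K$. Then $K$ admits no ghost characters; that is, every point of the fundamental variety $F_2(K)$ lifts to the trace-free slice $S_0(K)$.
   Context: Wirtinger data: $D_K$ has $n\ge 1$ crossings, hence arcs $1,\dots,n$, with Wirtinger presentation $G(K)=\langle m_1,\dots,m_n\mid r_1,\dots,r_{n-1}\rangle$ of the knot group $G(K)=\pi_1(E_K)$ ($E_K$ the knot exterior), where $m_i$ is the meridian of arc $i$. At each crossing with overarc $i$ and underarcs $j,k$ (labelled so that $j<k$), $(i,j,k)$ is called a Wirtinger triple. Fundamental variety: $F_2(K)\subset\mathbb{C}^{\binom n2}$ is the set of points $(x_{ij})_{1\le i<j\le n}$ such that $x_{ak}=x_{ij}x_{ai}-x_{aj}$ for every Wirtinger triple $(i,j,k)$ and every $1\le a\le n$, with the convention $x_{ii}=2$, $x_{ji}=x_{ij}$. Trace-free slice: $\rho:G(K)\to\mathrm{SL}_2(\mathbb{C})$ is trace-free if $\mathrm{tr}\,\rho(\text{meridian})=0$. $S_0(K)\subset\mathbb{C}^{\binom n2+\binom n3}$ is the closed algebraic set of points $(x_{ij};x_{ijk})$ with $x_{ij}=-\mathrm{tr}\,\rho(m_im_j)$ $(i<j)$ and $x_{ijk}=-\mathrm{tr}\,\rho(m_im_jm_k)$ $(i<j<k)$, $\rho$ ranging over trace-free representations. Let $q:S_0(K)\to F_2(K)$, $(x_{ij};x_{ijk})\mapsto(x_{ij})$ (its image does lie in $F_2(K)$). Ghost characters: a ghost character of $K$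 is a point of $F_2(K)$ that does not lift to $S_0(K)$, i.e. is not in the image of $q$. *)

theory Defs
  imports
    "HOL-Analysis.Analysis"
    "HOL-Algebra.Group"
    "HOL-Combinatorics.Orbits"
begin

section \<open>Knot diagrams\<close>

text \<open>
  An oriented knot diagram on the 2-sphere is recorded by its signed Gauss code: travel once along
  the knot from a base point and write down each crossing that is met, whether it is met on the
  over- or on the understrand, and the sign of the crossing (positive = right-handed).
  The empty code is the diagram of the unknot without crossings.
\<close>

datatype visit = Visit (label: nat) (is_over: bool) (is_pos: bool)

type_synonym gauss_code = "visit list"

fun mate :: "visit \<Rightarrow> visit" where
  "mate (Visit c b s) = Visit c (\<not> b) s"

definition is_gauss_code :: "gauss_code \<Rightarrow> bool" where
  "is_gauss_code D \<longleftrightarrow> distinct D \<and>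
     (\<forall>v\<in>set D. mate v \<in> set D \<and> (\<forall>w\<in>set D. label w = label v \<longrightarrow> w = v \<or> w = mate v))"

definition crossing_number :: "gauss_code \<Rightarrow> nat" where
  "crossing_number D = card (label ` set D)"

text \<open>
  Planarity. The pair \<open>(v, True)\<close> is the half-edge leaving the crossing after the visit \<open>v\<close> and
  \<open>(v, False)\<close> the half-edge arriving at the crossing at the visit \<open>v\<close>. The map
  \<open>other_end\<close> goes to the other half of the same edge, \<open>turn\<close> to the next half-edge
  counterclockwise around the same crossing. At a positive crossing the counterclockwise order is
  over-out, under-out, over-in, under-in; at a negative one it is over-out, under-in, over-in,
  under-out. The orbits of \<open>turn \<circ> other_end\<close> are the faces of the surface into which
  the underlying 4-valent graph (\<open>n\<close> vertices, \<open>2 n\<close> edges, connected) embeds; this surface is a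
  sphere iff \<open>n - 2 n + #faces = 2\<close>.
\<close>

definition next_visit :: "gauss_code \<Rightarrow> visit \<Rightarrow> visit" where
  "next_visit D v = the (map_of (zip D (rotate1 D)) v)"

definition prev_visit :: "gauss_code \<Rightarrow> visit \<Rightarrow> visit" where
  "prev_visit D v = the (map_of (zip (rotate1 D) D) v)"

fun other_end :: "gauss_code \<Rightarrow> visit \<times> bool \<Rightarrow> visit \<times> bool" where
  "other_end D (v, out) = (if out then (next_visit D v, False) else (prev_visit D v, True))"

fun turn :: "visit \<times> bool \<Rightarrow> visit \<times> bool" where
  "turn (v, out) = (mate v, out \<longleftrightarrow> (is_over v \<longleftrightarrow> is_pos v))"

definition faces :: "gauss_code \<Rightarrow> (visit \<times> bool) set set" where
  "faces D = (\<lambda>h. orbit (turn \<circ> other_end D) h) ` (set D \<times> UNIV)"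

definition planar :: "gauss_code \<Rightarrow> bool" where
  "planar D \<longleftrightarrow> D = [] \<or> card (faces D) = crossing_number D + 2"

definition knot_diagram :: "gauss_code \<Rightarrow> bool" where
  "knot_diagram D \<longleftrightarrow> is_gauss_code D \<and> planar D"


section \<open>Knots and the bridge index\<close>

text \<open>
  In the third move the top strand meets the middle one at \<open>a\<close> and the bottom one at \<open>b\<close>, and the
  middle strand meets the bottom one at \<open>c\<close>; \<open>sa\<close>, \<open>sb\<close>, \<open>sc\<close> are the signs of these crossings.
  Three directed lines in general position with these signs meet each other in exactly two
  possible orders, distinguished by \<open>k\<close>, and the move exchanges the two. (For directions
  \<open>t\<close>, \<open>m\<close>, \<open>l\<close> of the lines, \<open>sa\<close>, \<open>sb\<close>, \<open>sc\<close> are the signs of the cross products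
  \<open>t \<times> m\<close>, \<open>t \<times> l\<close>, \<open>m \<times> l\<close>; the iterated equivalence below is the product of the three signs.)
\<close>

definition triangle_strands ::
    "nat \<Rightarrow> nat \<Rightarrow> nat \<Rightarrow> bool \<Rightarrow> bool \<Rightarrow> bool \<Rightarrow> bool \<Rightarrow> gauss_code list" where
  "triangle_strands a b c sa sb sc k =
     (let dir = (\<lambda>forward p. if forward then p else rev p) in
      [dir (k \<longleftrightarrow> sb) [Visit a True sa, Visit b True sb],
       dir (k \<longleftrightarrow> sc) [Visit a False sa, Visit c True sc],
       dir (k \<longleftrightarrow> (sa \<longleftrightarrow> (sb \<longleftrightarrow> sc))) [Visit b False sb, Visit c False sc]])"

text \<open>
  \<open>rotate\<close> moves the base point and \<open>rename\<close> renames the crossings. By \<open>rotate\<close>, one of the places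
  where a Reidemeister move happens may be taken at the beginning of the code. The moves are only
  used between planar codes, see \<open>same_knot\<close> below.
\<close>

inductive reidemeister_move :: "gauss_code \<Rightarrow> gauss_code \<Rightarrow> bool" where
  rotate: "reidemeister_move D (rotate1 D)"
| rename: "inj f \<Longrightarrow> reidemeister_move D (map (\<lambda>v. Visit (f (label v)) (is_over v) (is_pos v)) D)"
| R1: "reidemeister_move D (Visit c b s # Visit c (\<not> b) s # D)"
| R2: "p = [Visit c False s, Visit d False (\<not> s)] \<or> p = [Visit d False (\<not> s), Visit c False s] \<Longrightarrow>
       reidemeister_move (u @ v) ([Visit c True s, Visit d True (\<not> s)] @ u @ p @ v)"
| R3: "mset [p, q, r] = mset (triangle_strands a b c sa sb sc k) \<Longrightarrow>
       reidemeister_move (p @ u @ q @ v @ r @ w) (rev p @ u @ rev q @ v @ rev r @ w)"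

inductive same_knot :: "gauss_code \<Rightarrow> gauss_code \<Rightarrow> bool" where
  refl: "knot_diagram D \<Longrightarrow> same_knot D D"
| move: "knot_diagram D \<Longrightarrow> knot_diagram D' \<Longrightarrow> reidemeister_move D D' \<Longrightarrow> same_knot D D'"
| sym: "same_knot D D' \<Longrightarrow> same_knot D' D"
| trans: "same_knot D D' \<Longrightarrow> same_knot D' D'' \<Longrightarrow> same_knot D D''"

text \<open>
  A knot (type) in the 3-sphere is the class of all its diagrams, \<open>D \<in> K\<close> says that \<open>D\<close> is a
  diagram of \<open>K\<close>.
\<close>

definition knots :: "gauss_code set set" where
  "knots = {D. knot_diagram D} // {(D, D'). same_knot D D'}"

text \<open>
  The arcs run from one undercrossing to the next one; arc \<open>0\<close> contains the base point, and the
  others follow in the order of the orientation. \<open>arc_at D p\<close> is the arc on which one arrives at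
  the visit \<open>D ! p\<close>; so if this is an undercrossing, one leaves it on \<open>arc_at D (Suc p)\<close>.
\<close>

definition arc_at :: "gauss_code \<Rightarrow> nat \<Rightarrow> nat" where
  "arc_at D p = length (filter (\<lambda>v. \<not> is_over v) (take p D)) mod crossing_number D"

text \<open>The crossings as tuples (overarc, incoming underarc, outgoing underarc, sign).\<close>

definition crossings :: "gauss_code \<Rightarrow> (nat \<times> nat \<times> nat \<times> bool) set" where
  "crossings D = {(arc_at D q, arc_at D p, arc_at D (Suc p), is_pos (D ! p)) | p q.
     p < length D \<and> q < length D \<and> \<not> is_over (D ! p) \<and> D ! q = mate (D ! p)}"

text \<open>
  The bridges of a diagram are the arcs that pass over at least one crossing; by convention, the
  circle without crossings has one bridge.
\<close>

definition bridge_number :: "gauss_code \<Rightarrow> nat" where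
  "bridge_number D = (if D = [] then 1 else card (fst ` crossings D))"

definition bridge_index :: "gauss_code set \<Rightarrow> nat" where
  "bridge_index K = (INF D\<in>K. bridge_number D)"


section \<open>The knot group\<close>

text \<open>Words are lists of pairs \<open>(g, e)\<close>; \<open>e = False\<close> stands for the inverse of \<open>g\<close>.\<close>

type_synonym 'g word = "('g \<times> bool) list"

inductive word_eq :: "'g word set \<Rightarrow> 'g word \<Rightarrow> 'g word \<Rightarrow> bool" for R where
  refl: "word_eq R u u"
| sym: "word_eq R u v \<Longrightarrow> word_eq R v u"
| trans: "word_eq R u v \<Longrightarrow> word_eq R v w \<Longrightarrow> word_eq R u w"
| cancel: "word_eq R (u @ [(g, e), (g, \<not> e)] @ v) (u @ v)"
| relator: "r \<in> R \<Longrightarrow> word_eq R (u @ r @ v) (u @ v)"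

definition word_class :: "'g set \<Rightarrow> 'g word set \<Rightarrow> 'g word \<Rightarrow> 'g word set" where
  "word_class X R u = {v \<in> lists (X \<times> UNIV). word_eq R u v}"

definition presented_group :: "'g set \<Rightarrow> 'g word set \<Rightarrow> 'g word set monoid" where
  "presented_group X R =
     \<lparr>carrier = word_class X R ` lists (X \<times> UNIV),
      mult = (\<lambda>A B. \<Union>a\<in>A. \<Union>b\<in>B. word_class X R (a @ b)),
      one = word_class X R []\<rparr>"

text \<open>
  The arcs \<open>0, \<dots>, n - 1\<close> of the diagram are numbered \<open>1, \<dots>, n\<close> in an arbitrary way.
\<close>

definition arc_numbering :: "gauss_code \<Rightarrow> (nat \<Rightarrow> nat) \<Rightarrow> bool" where
  "arc_numbering D \<nu> \<longleftrightarrow> bij_betw \<nu> {..<crossing_number D} {1..crossing_number D}"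

text \<open>
  Wirtinger relators: \<open>m\<^sub>k = m\<^sub>i\<inverse> m\<^sub>j m\<^sub>i\<close> at a positive and \<open>m\<^sub>k = m\<^sub>i m\<^sub>j m\<^sub>i\<inverse>\<close> at a negative
  crossing with overarc \<open>i\<close>, incoming underarc \<open>j\<close> and outgoing underarc \<open>k\<close>. All \<open>n\<close> relators are
  listed; any one of them is a consequence of the others and is often omitted.
\<close>

definition wirtinger_relators :: "gauss_code \<Rightarrow> (nat \<Rightarrow> nat) \<Rightarrow> nat word set" where
  "wirtinger_relators D \<nu> =
     {[(\<nu> k, False), (\<nu> i, \<not> s), (\<nu> j, True), (\<nu> i, s)] | i j k s. (i, j, k, s) \<in> crossings D}"

definition knot_group :: "gauss_code \<Rightarrow> (nat \<Rightarrow> nat) \<Rightarrow> nat word set monoid" where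
  "knot_group D \<nu> = presented_group {1..crossing_number D} (wirtinger_relators D \<nu>)"

definition meridian :: "gauss_code \<Rightarrow> (nat \<Rightarrow> nat) \<Rightarrow> nat \<Rightarrow> nat word set" where
  "meridian D \<nu> i = word_class {1..crossing_number D} (wirtinger_relators D \<nu>) [(i, True)]"


section \<open>The fundamental variety, the trace-free slice and ghost characters\<close>

definition index_pairs :: "nat \<Rightarrow> (nat \<times> nat) set" where
  "index_pairs n = {(i, j). 1 \<le> i \<and> i < j \<and> j \<le> n}"

definition index_triples :: "nat \<Rightarrow> (nat \<times> nat \<times> nat) set" where
  "index_triples n = {(i, j, k). 1 \<le> i \<and> i < j \<and> j < k \<and> k \<le> n}"

text \<open>The convention \<open>x\<^sub>i\<^sub>i = 2\<close>, \<open>x\<^sub>j\<^sub>i = x\<^sub>i\<^sub>j\<close>.\<close>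

definition coord :: "(nat \<times> nat \<Rightarrow> complex) \<Rightarrow> nat \<Rightarrow> nat \<Rightarrow> complex" where
  "coord x i j = (if i = j then 2 else if i < j then x (i, j) else x (j, i))"

text \<open>
  The two underarcs at a crossing are different except for the diagrams with one crossing, whose
  only triple is \<open>(1, 1, 1)\<close>.
\<close>

definition wirtinger_triples :: "gauss_code \<Rightarrow> (nat \<Rightarrow> nat) \<Rightarrow> (nat \<times> nat \<times> nat) set" where
  "wirtinger_triples D \<nu> =
     {(\<nu> i, min (\<nu> j) (\<nu> k), max (\<nu> j) (\<nu> k)) | i j k s. (i, j, k, s) \<in> crossings D}"

text \<open>
  Affine spaces with coordinates indexed by a finite set \<open>I\<close> are rendered as
  \<open>I \<rightarrow>\<^sub>E UNIV\<close>.
\<close>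

definition fundamental_variety ::
    "gauss_code \<Rightarrow> (nat \<Rightarrow> nat) \<Rightarrow> (nat \<times> nat \<Rightarrow> complex) set" where
  "fundamental_variety D \<nu> =
     {x \<in> index_pairs (crossing_number D) \<rightarrow>\<^sub>E UNIV.
        \<forall>(i, j, k) \<in> wirtinger_triples D \<nu>. \<forall>a \<in> {1..crossing_number D}.
          coord x a k = coord x i j * coord x a i - coord x a j}"

definition SL2 :: "(complex^2^2) monoid" where
  "SL2 = \<lparr>carrier = {A. det A = 1}, mult = (**), one = mat 1\<rparr>"

definition trace_free_reps ::
    "gauss_code \<Rightarrow> (nat \<Rightarrow> nat) \<Rightarrow> (nat word set \<Rightarrow> complex^2^2) set" where
  "trace_free_reps D \<nu> =
     {\<rho> \<in> hom (knot_group D \<nu>) SL2. \<forall>i \<in> {1..crossing_number D}. trace (\<rho> (meridian D \<nu> i)) = 0}"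

definition trace_free_slice ::
    "gauss_code \<Rightarrow> (nat \<Rightarrow> nat) \<Rightarrow>
      ((nat \<times> nat \<Rightarrow> complex) \<times> (nat \<times> nat \<times> nat \<Rightarrow> complex)) set" where
  "trace_free_slice D \<nu> =
     (let G = knot_group D \<nu>; m = meridian D \<nu>; n = crossing_number D in
      {(\<lambda>(i, j) \<in> index_pairs n. - trace (\<rho> (m i \<otimes>\<^bsub>G\<^esub> m j)),
        \<lambda>(i, j, k) \<in> index_triples n. - trace (\<rho> (m i \<otimes>\<^bsub>G\<^esub> m j \<otimes>\<^bsub>G\<^esub> m k)))
       | \<rho>. \<rho> \<in> trace_free_reps D \<nu>})"

definition slice_projection ::
    "(nat \<times> nat \<Rightarrow> complex) \<times> (nat \<times> nat \<times> nat \<Rightarrow> complex) \<Rightarrow> (nat \<times> nat \<Rightarrow> complex)" where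
  "slice_projection = fst"

definition ghost_characters ::
    "gauss_code \<Rightarrow> (nat \<Rightarrow> nat) \<Rightarrow> (nat \<times> nat \<Rightarrow> complex) set" where
  "ghost_characters D \<nu> = fundamental_variety D \<nu> - slice_projection ` trace_free_slice D \<nu>"

end

theory Submission
  imports Defs "HOL-Library.Function_Algebras"
begin

text \<open>
  A point \<open>x\<close> of the fundamental variety is a Gram matrix. Modulo the radical of the form, the
  defining equations say that the vectors on the two underarcs of a crossing are exchanged by the
  half-turn about the vector on the overarc. So \<open>x\<close> is a colouring of the arcs by the quandle of
  vectors of norm 2 in a nondegenerate complex quadratic space. Reidemeister moves carry colourings
  to colourings with the same span, and in a diagram with \<open>b\<close> bridges the colours of the bridges
  span; hence the colours of every diagram of a knot of bridge index at most 3 span a space of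
  dimension at most 3. This space embeds isometrically into the trace-free \<open>2 \<times> 2\<close> matrices with
  the form \<open>- trace (A B)\<close>, where the half-turn is conjugation, so the images of the vectors
  satisfy the Wirtinger relations.
\<close>

section \<open>Quadratic spaces\<close>

locale quadratic_space = vector_space scale
  for scale :: "complex \<Rightarrow> 'v::ab_group_add \<Rightarrow> 'v" (infixr "\<cdot>" 75) +
  fixes form :: "'v \<Rightarrow> 'v \<Rightarrow> complex"
  assumes form_sym: "form u v = form v u"
    and form_add: "form (u + v) w = form u w + form v w"
    and form_scale: "form (a \<cdot> u) w = a * form u w"
begin

lemma form_add_right: "form w (u + v) = form w u + form w v"
  by (metis form_add form_sym)

lemma form_scale_right: "form w (a \<cdot> u) = a * form w u"
  by (metis form_scale form_sym)

lemma form_diff: "form (u - v) w = form u w - form v w"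
  using form_add[of "u - v" v w] by simp

lemma form_diff_right: "form w (u - v) = form w u - form w v"
  by (metis form_diff form_sym)

lemma form_zero: "form 0 w = 0"
  using form_add[of 0 0 w] by simp

lemmas form_simps = form_add form_add_right form_scale form_scale_right form_diff form_diff_right

lemma form_eq_0_span:
  assumes "\<And>s. s \<in> S \<Longrightarrow> form s v = 0" and "u \<in> span S"
  shows "form u v = 0"
  using assms(2)
  by (induction rule: span_induct_alt) (simp_all add: form_zero form_add form_scale assms(1))

text \<open>Gram-Schmidt. Over the complex numbers a nonzero form has a vector \<open>w\<close> of norm 1; subtracting
  the square of \<open>form _ w\<close> puts \<open>w\<close> into the radical and one spanning vector becomes superfluous.
  By the last conjunct, relations that hold modulo the radical become true relations between the
  coordinate vectors.\<close>

lemma exists_orthonormal_coordinates: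
  assumes "quadratic_space scale b" "finite T" "card T \<le> m"
  shows "\<exists>\<phi>. (\<forall>k u v. \<phi> k (u + v) = \<phi> k u + \<phi> k v) \<and> (\<forall>k a u. \<phi> k (scale a u) = a * \<phi> k u)
    \<and> (\<forall>u\<in>span T. \<forall>v\<in>span T. b u v = (\<Sum>k<m. \<phi> k u * \<phi> k v))
    \<and> (\<forall>u. (\<forall>v. b u v = 0) \<longrightarrow> (\<forall>k. \<phi> k u = 0))"
  using assms
proof (induction m arbitrary: b T)
  case 0
  interpret b: quadratic_space scale b by fact
  from 0 have "T = {}" by simp
  then show ?case
    by (intro exI[of _ "\<lambda>k u. 0"]) (simp add: b.form_zero)
next
  case (Suc m)
  interpret b: quadratic_space scale b by fact
  show ?case
  proof (cases "\<forall>s\<in>T. \<forall>t\<in>T. b s t = 0")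
    case True
    have "b u v = 0" if "u \<in> span T" "v \<in> span T" for u v
      using that True b.form_eq_0_span[of T] b.form_sym by metis
    then show ?thesis
      by (intro exI[of _ "\<lambda>k u. 0"]) simp
  next
    case False
    \<comment> \<open>Polarisation: if every vector of \<open>T\<close> is isotropic, then
      \<open>b (s + t) (s + t) = 2 * b s t\<close>, which is nonzero for some pair. If some
      \<open>s\<close> is not isotropic, \<open>t = 0\<close> serves.\<close>
    obtain s t where st: "s \<in> T" "t = 0 \<or> t \<in> T - {s}" "b (s + t) (s + t) \<noteq> 0"
    proof (cases "\<exists>s\<in>T. b s s \<noteq> 0")
      case True
      then show ?thesis using that[of _ 0] by auto
    next
      case iso: False
      from False obtain s t where "s \<in> T" "t \<in> T" "b s t \<noteq> 0" by blast
      with iso show ?thesis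
        by (intro that[of s t]) (auto simp: b.form_simps b.form_sym)
    qed
    define r where "r = csqrt (b (s + t) (s + t))"
    define w where "w = (1 / r) \<cdot> (s + t)"
    have r: "r \<noteq> 0" "r * r = b (s + t) (s + t)"
      using st(3) by (auto simp: r_def power2_eq_square[symmetric])
    have w1: "b w w = 1"
      unfolding w_def b.form_scale b.form_scale_right r(2)[symmetric] using r(1) by simp
    define T' where "T' = T - {s}"
    have T': "finite T'" "card T' \<le> m" "T = insert s T'"
      using Suc.prems st(1) by (auto simp: T'_def)
    \<comment> \<open>By this equation \<open>w\<close> can replace \<open>s\<close> among the
      spanning vectors, which leaves \<open>T'\<close>, with one element fewer, for the
      induction.\<close>
    have "s = r \<cdot> w - t" using r by (simp add: w_def)
    moreover have "t \<in> span (insert w T')"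
      using st(2) by (auto simp: T'_def span_zero intro: span_base)
    ultimately have "s \<in> span (insert w T')"
      by (metis insertI1 span_base span_diff span_scale)
    then have sub: "span T \<subseteq> span (insert w T')"
      unfolding T'(3) by (intro span_minimal subspace_span) (auto intro: span_base)
    define b' where "b' u v = b u v - b u w * b v w" for u v
    have qs': "quadratic_space scale b'"
      by unfold_locales (auto simp: b'_def b.form_simps algebra_simps b.form_sym)
    interpret b': quadratic_space scale b' by (fact qs')
    obtain \<phi> where
      "(\<forall>k u v. \<phi> k (u + v) = \<phi> k u + \<phi> k v) \<and> (\<forall>k a u. \<phi> k (a \<cdot> u) = a * \<phi> k u)
       \<and> (\<forall>u\<in>span T'. \<forall>v\<in>span T'. b' u v = (\<Sum>k<m. \<phi> k u * \<phi> k v))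
       \<and> (\<forall>u. (\<forall>v. b' u v = 0) \<longrightarrow> (\<forall>k. \<phi> k u = 0))"
      using Suc.IH[OF qs' T'(1,2)] by (rule exE)
    then have add: "\<phi> k (u + v) = \<phi> k u + \<phi> k v" and sc: "\<phi> k (a \<cdot> u) = a * \<phi> k u"
      and gram: "u \<in> span T' \<Longrightarrow> v \<in> span T' \<Longrightarrow> b' u v = (\<Sum>k<m. \<phi> k u * \<phi> k v)"
      and rad: "(\<And>v. b' u v = 0) \<Longrightarrow> \<phi> k u = 0" for k a u v
      by blast+
    have w0: "b' w v = 0" for v using w1 b.form_sym[of v w] by (simp add: b'_def)
    have \<phi>w: "\<phi> k w = 0" for k using rad w0 by blast
    have main: "b u v = (\<Sum>k<m. \<phi> k u * \<phi> k v) + b u w * b v w"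
      if "u \<in> span T" "v \<in> span T" for u v
    proof -
      \<comment> \<open>Both \<open>b' w\<close> and \<open>\<phi> _ w\<close> vanish, so
        \<open>u\<close> and \<open>v\<close> may be changed by multiples of \<open>w\<close> to
        bring them into \<open>span T'\<close>, where the induction hypothesis applies.\<close>
      from that sub obtain \<alpha> \<beta> where
        uv: "u - \<alpha> \<cdot> w \<in> span T'" "v - \<beta> \<cdot> w \<in> span T'"
        using span_breakdown_eq by blast
      have \<phi>: "\<phi> k (y - a \<cdot> w) = \<phi> k y" for k y a
        using add[of k "y - a \<cdot> w" "a \<cdot> w"] by (simp add: sc \<phi>w)
      have "b' u v = b' (u - \<alpha> \<cdot> w) (v - \<beta> \<cdot> w)"
        using w0 b'.form_sym by (simp add: b'.form_simps)
      also have "\<dots> = (\<Sum>k<m. \<phi> k u * \<phi> k v)" using gram[OF uv] by (simp add: \<phi>)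
      finally show ?thesis by (simp add: b'_def diff_eq_eq)
    qed
    let ?\<phi> = "\<lambda>k u. if k = m then b u w else \<phi> k u"
    have "\<phi> k u = 0" if "\<forall>v. b u v = 0" for k u
      using that by (intro rad) (simp add: b'_def)
    then show ?thesis
      by (intro exI[of _ ?\<phi>]) (simp add: add sc b.form_add b.form_scale main)
  qed
qed

end

section \<open>Colourings\<close>

context quadratic_space
begin

text \<open>\<open>u \<star> v\<close> is the half-turn of \<open>u\<close> about \<open>v\<close> when \<open>form v v = 2\<close>; these vectors form an
  involutory quandle, so the orientations and signs of the crossings play no role.\<close>

definition act :: "'v \<Rightarrow> 'v \<Rightarrow> 'v" (infixl "\<star>" 70) where
  "u \<star> v = form u v \<cdot> v - u"

lemma act_self: "form v v = 2 \<Longrightarrow> v \<star> v = v"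
  using scale_left_distrib[of 1 1 v] by (simp add: act_def)

lemma act_act: "form v v = 2 \<Longrightarrow> u \<star> v \<star> v = u"
  by (simp add: act_def form_simps)

lemma act_isometry: "form w w = 2 \<Longrightarrow> form (u \<star> w) (v \<star> w) = form u v"
  by (simp add: act_def form_simps algebra_simps form_sym)

text \<open>The half-turn about \<open>w\<close> is a linear isometry, so it carries the half-turn
  about \<open>v\<close> to the one about \<open>v \<star> w\<close>. This identity is what the
  third Reidemeister move requires.\<close>

lemma act_distrib:
  assumes "form w w = 2"
  shows "u \<star> v \<star> w = (u \<star> w) \<star> (v \<star> w)"
proof -
  have "(u \<star> w) \<star> (v \<star> w) = form u v \<cdot> (v \<star> w) - u \<star> w"
    using act_isometry[OF assms] by (simp add: act_def)
  then show ?thesis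
    by (simp add: act_def form_simps scale_right_diff_distrib scale_left_diff_distrib)
qed

lemma act_mem_span: "u \<in> span T \<Longrightarrow> v \<in> span T \<Longrightarrow> u \<star> v \<in> span T"
  by (simp add: act_def span_diff span_scale)

text \<open>\<open>c l\<close> is the colour of the overstrand at the crossing \<open>l\<close>; the strand \<open>D\<close> starts with the
  colour \<open>x\<close> and ends with \<open>y\<close>.\<close>

fun path :: "(nat \<Rightarrow> 'v) \<Rightarrow> 'v \<Rightarrow> visit list \<Rightarrow> 'v \<Rightarrow> bool" where
  "path c x [] y \<longleftrightarrow> x = y"
| "path c x (v # D) y \<longleftrightarrow>
     (if is_over v then c (label v) = x \<and> path c x D y else path c (x \<star> c (label v)) D y)"

lemma path_append: "path c x (D @ E) z \<longleftrightarrow> (\<exists>y. path c x D y \<and> path c y E z)"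
  by (induction D arbitrary: x) auto

lemma path_cong: "(\<And>l. l \<in> label ` set D \<Longrightarrow> c l = c' l) \<Longrightarrow> path c x D y \<longleftrightarrow> path c' x D y"
  by (induction D arbitrary: x) auto

definition colouring :: "(nat \<Rightarrow> 'v) \<Rightarrow> 'v \<Rightarrow> gauss_code \<Rightarrow> bool" where
  "colouring c x D \<longleftrightarrow>
     form x x = 2 \<and> (\<forall>l\<in>label ` set D. form (c l) (c l) = 2) \<and> path c x D x"

text \<open>An undercrossing adds a multiple of an overstrand colour up to sign, and the half-turn
  is its own inverse. So membership in a span containing all overstrand colours passes along a
  strand in both directions.\<close>

lemma path_mem_span_iff:
  assumes "path c x D y" "\<And>l. l \<in> label ` set D \<Longrightarrow> form (c l) (c l) = 2"
    "c ` label ` set D \<subseteq> span T"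
  shows "x \<in> span T \<longleftrightarrow> y \<in> span T"
  using assms
proof (induction D arbitrary: x)
  case (Cons v D)
  show ?case
  proof (cases "is_over v")
    case False
    have "x \<in> span T \<longleftrightarrow> x \<star> c (label v) \<in> span T"
    proof -
      have "form (c (label v)) (c (label v)) = 2" and v: "c (label v) \<in> span T"
        using Cons.prems(2,3) by simp_all
      then have "x \<star> c (label v) \<star> c (label v) = x" by (simp only: act_act)
      then show ?thesis using act_mem_span[OF _ v] by metis
    qed
    then show ?thesis using Cons False by simp
  qed (use Cons in simp)
qed simp

lemma path_norm:
  assumes "path c x D y" "\<And>l. l \<in> label ` set D \<Longrightarrow> form (c l) (c l) = 2"
  shows "form y y = form x x"
  using assms by (induction D arbitrary: x) (auto split: if_splits simp: act_isometry)

text \<open>This bounds the dimension of the span of all colours by \<open>k\<close>. The start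
  colour \<open>x\<close> is listed separately because the empty code has no labels to carry
  it.\<close>

definition colour_rank_le :: "nat \<Rightarrow> gauss_code \<Rightarrow> bool" where
  "colour_rank_le k D \<longleftrightarrow> (\<forall>c x. colouring c x D \<longrightarrow>
     (\<exists>T. finite T \<and> card T \<le> k \<and> insert x (c ` label ` set D) \<subseteq> span T))"

text \<open>This is one half of invariance: a rank bound for \<open>D'\<close> is inherited by
  \<open>D\<close>. Comparing spans instead of colours allows for moves that change or remove
  colours.\<close>

definition embeds :: "gauss_code \<Rightarrow> gauss_code \<Rightarrow> bool" where
  "embeds D D' \<longleftrightarrow> (\<forall>c x. colouring c x D \<longrightarrow> (\<exists>c' x'. colouring c' x' D' \<and>
     insert x (c ` label ` set D) \<subseteq> span (insert x' (c' ` label ` set D'))))"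

lemma colour_rank_le_embeds:
  assumes "embeds D D'" "colour_rank_le k D'"
  shows "colour_rank_le k D"
  unfolding colour_rank_le_def
proof (intro allI impI)
  fix c x assume "colouring c x D"
  with assms obtain c' x' T where *: "finite T" "card T \<le> k"
    "insert x (c ` label ` set D) \<subseteq> span (insert x' (c' ` label ` set D'))"
    "insert x' (c' ` label ` set D') \<subseteq> span T"
    unfolding embeds_def colour_rank_le_def by metis
  then have "insert x (c ` label ` set D) \<subseteq> span T"
    using span_minimal[OF *(4) subspace_span] by blast
  with * show "\<exists>T. finite T \<and> card T \<le> k \<and> insert x (c ` label ` set D) \<subseteq> span T" by blast
qed

lemma embedsI:
  assumes "\<And>c x. colouring c x D \<Longrightarrow> \<exists>c' x'. colouring c' x' D' \<and>
     insert x (c ` label ` set D) \<subseteq> span (insert x' (c' ` label ` set D'))"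
  shows "embeds D D'"
  using assms by (auto simp: embeds_def)

lemma embeds_witness:
  assumes "colouring c' x' D'" "A \<subseteq> insert x' (c' ` label ` set D')"
  shows "\<exists>c' x'. colouring c' x' D' \<and> A \<subseteq> span (insert x' (c' ` label ` set D'))"
  using assms(1) subset_trans[OF assms(2) span_superset] by blast

section \<open>Colourings under the individual Reidemeister moves\<close>

lemma embeds_rotate: "embeds D (rotate1 D)" "embeds (rotate1 D) D"
proof -
  \<comment> \<open>The colours at the old and the new base point are joined by a strand of
    \<open>D\<close>, so either one lies in the span of the other and the overstrand
    colours.\<close>
  have key: "insert x (c ` label ` set D) \<subseteq> span (insert y (c ` label ` set D))"
    if "path c x E y \<or> path c y E x" "set E \<subseteq> set D"
      "\<And>l. l \<in> label ` set D \<Longrightarrow> form (c l) (c l) = 2" for c x y E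
  proof -
    have "c ` label ` set E \<subseteq> span (insert y (c ` label ` set D))"
      using that(2) by (auto intro!: span_base)
    then have "x \<in> span (insert y (c ` label ` set D))"
      using that path_mem_span_iff[of c x E y "insert y (c ` label ` set D)"]
        path_mem_span_iff[of c y E x "insert y (c ` label ` set D)"]
      by (metis image_mono insertI1 span_base subsetD)
    then show ?thesis by (auto intro: span_base)
  qed
  show "embeds D (rotate1 D)"
  proof (cases D)
    case (Cons v E)
    show ?thesis
    proof (rule embedsI)
      fix c x assume c: "colouring c x D"
      then obtain y where y: "path c x [v] y" "path c y E x"
        using Cons path_append[of c x "[v]" E x] by (auto simp: colouring_def)
      have "colouring c y (rotate1 D)"
        using c y Cons path_norm[OF y(1)] by (auto simp: colouring_def path_append)
      moreover have "insert x (c ` label ` set D) \<subseteq> span (insert y (c ` label ` set D))"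
        using key[of c x "[v]" y] y c Cons by (auto simp: colouring_def)
      ultimately show "\<exists>c' x'. colouring c' x' (rotate1 D) \<and>
          insert x (c ` label ` set D) \<subseteq> span (insert x' (c' ` label ` set (rotate1 D)))"
        by auto
    qed
  qed (auto intro!: embedsI span_base)
  show "embeds (rotate1 D) D"
  proof (cases D)
    case (Cons v E)
    show ?thesis
    proof (rule embedsI)
      fix c x assume c: "colouring c x (rotate1 D)"
      then obtain y where y: "path c x E y" "path c y [v] x"
        using Cons by (auto simp: colouring_def path_append simp del: path.simps)
      have "path c y (v # E) y"
        using path_append[of c y "[v]" E y] y by auto
      then have "colouring c y D"
        using c Cons path_norm[OF y(1)] by (auto simp: colouring_def)
      moreover have "insert x (c ` label ` set D) \<subseteq> span (insert y (c ` label ` set D))"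
        using key[of c x "[v]" y] y c Cons by (auto simp: colouring_def)
      ultimately show "\<exists>c' x'. colouring c' x' D \<and>
          insert x (c ` label ` set (rotate1 D)) \<subseteq> span (insert x' (c' ` label ` set D))"
        by auto
    qed
  qed (auto intro!: embedsI span_base)
qed

lemma path_rename:
  "path c x (map (\<lambda>v. Visit (f (label v)) (is_over v) (is_pos v)) D) y \<longleftrightarrow> path (c \<circ> f) x D y"
  by (induction D arbitrary: x) auto

lemma embeds_rename:
  fixes f :: "nat \<Rightarrow> nat"
  assumes "inj f"
  defines "F \<equiv> map (\<lambda>v. Visit (f (label v)) (is_over v) (is_pos v))"
  shows "embeds D (F D)" "embeds (F D) D"
proof -
  have L: "label ` set (F D) = f ` label ` set D" by (auto simp: F_def image_iff)
  have P: "path c x (F D) y \<longleftrightarrow> path (c \<circ> f) x D y" for c x y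
    unfolding F_def by (rule path_rename)
  have C: "colouring c x (F D) \<longleftrightarrow> colouring (c \<circ> f) x D" for c x
    by (simp add: colouring_def L P)
  show "embeds (F D) D"
    by (rule embedsI) (auto simp: C L intro!: exI span_base)
  show "embeds D (F D)"
  proof (rule embedsI)
    fix c x assume c: "colouring c x D"
    \<comment> \<open>The colouring is carried to the renamed code along a left inverse of
      \<open>f\<close>.\<close>
    have "c = (c \<circ> inv_into UNIV f) \<circ> f" using assms(1) by auto
    then show "\<exists>c' x'. colouring c' x' (F D) \<and>
        insert x (c ` label ` set D) \<subseteq> span (insert x' (c' ` label ` set (F D)))"
      using c span_superset
      by (intro exI[of _ "c \<circ> inv_into UNIV f"] exI[of _ x]) (simp add: C L assms(1) image_comp)
  qed
qed

text \<open>The overstrand of a kink is forced to have the colour \<open>x\<close> of the strand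
  itself. If the underpass comes first, \<open>x \<star> c l = c l\<close>, and applying the
  half-turn about \<open>c l\<close> once more gives \<open>x = c l\<close>.\<close>

lemma embeds_R1:
  fixes b s :: bool
  assumes "l \<notin> label ` set D"
  defines "E \<equiv> Visit l b s # Visit l (\<not> b) s # D"
  shows "embeds D E" "embeds E D"
proof -
  show "embeds D E"
  proof (rule embedsI)
    fix c x assume c: "colouring c x D"
    have "path (c(l := x)) x D x \<longleftrightarrow> path c x D x"
      using assms(1) by (intro path_cong) auto
    with c have "colouring (c(l := x)) x E"
      by (auto simp: colouring_def E_def act_self)
    moreover have "insert x (c ` label ` set D) \<subseteq> insert x (c(l := x) ` label ` set E)"
      using assms(1) by (auto simp: E_def)
    ultimately show "\<exists>c' x'. colouring c' x' E \<and>
        insert x (c ` label ` set D) \<subseteq> span (insert x' (c' ` label ` set E))"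
      by (rule embeds_witness)
  qed
  show "embeds E D"
  proof (rule embedsI)
    fix c x assume c: "colouring c x E"
    then have x: "form x x = 2" and norm: "\<forall>k\<in>label ` set E. form (c k) (c k) = 2"
      and path: "path c x E x"
      unfolding colouring_def by blast+
    have n: "form (c l) (c l) = 2" using norm by (simp add: E_def)
    have *: "c l = x \<and> path c x D x"
    proof (cases b)
      case True
      with path n show ?thesis by (auto simp: E_def act_self)
    next
      case False
      with path have *: "x \<star> c l = c l" "path c (x \<star> c l) D x"
        unfolding E_def path.simps visit.sel by metis+
      have "x = x \<star> c l \<star> c l" using n by (simp only: act_act)
      also have "\<dots> = c l" using n by (simp only: *(1) act_self)
      finally have "x = c l" .
      with * show ?thesis by simp
    qed
    then have "colouring c x D"
      using x norm by (simp add: colouring_def E_def)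
    moreover have "insert x (c ` label ` set E) \<subseteq> insert x (c ` label ` set D)"
      using * by (auto simp: E_def)
    ultimately show "\<exists>c' x'. colouring c' x' D \<and>
        insert x (c ` label ` set E) \<subseteq> span (insert x' (c' ` label ` set D))"
      by (rule embeds_witness)
  qed
qed

text \<open>Both new crossings have the overstrand colour \<open>x\<close>, so the lower strand is
  turned twice about \<open>x\<close> and leaves with the colour it came with.\<close>

lemma embeds_R2:
  fixes s :: bool
  assumes new: "l \<notin> label ` set (u @ v)" "m \<notin> label ` set (u @ v)"
    and p: "p = [Visit l False s, Visit m False (\<not> s)] \<or> p = [Visit m False (\<not> s), Visit l False s]"
  defines "E \<equiv> [Visit l True s, Visit m True (\<not> s)] @ u @ p @ v"
  shows "embeds (u @ v) E" "embeds E (u @ v)"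
proof -
  have pp: "path c y p z \<longleftrightarrow> y = z"
    if "c l = x" "c m = x" "form x x = 2" for c x y z
    using p that by (auto simp: act_act)
  have PE: "path c x E x \<longleftrightarrow> c l = x \<and> c m = x \<and> path c x (u @ v) x"
    if "form x x = 2" for c x
    using pp[of c x] that by (auto simp: E_def path_append)
  have LE: "label ` set E = {l, m} \<union> label ` set (u @ v)"
    using p by (auto simp: E_def)
  show "embeds (u @ v) E"
  proof (rule embedsI)
    fix c x assume c: "colouring c x (u @ v)"
    let ?c = "c(l := x, m := x)"
    have "path ?c x (u @ v) x \<longleftrightarrow> path c x (u @ v) x"
      using new by (intro path_cong) auto
    with c have "colouring ?c x E"
      by (auto simp: colouring_def PE LE)
    moreover have "insert x (c ` label ` set (u @ v)) \<subseteq> insert x (?c ` label ` set E)"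
      using new unfolding LE by (auto simp: image_iff)
    ultimately show "\<exists>c' x'. colouring c' x' E \<and>
        insert x (c ` label ` set (u @ v)) \<subseteq> span (insert x' (c' ` label ` set E))"
      by (rule embeds_witness)
  qed
  show "embeds E (u @ v)"
  proof (rule embedsI)
    fix c x assume "colouring c x E"
    then have "form x x = 2" and "\<forall>k\<in>label ` set E. form (c k) (c k) = 2" and "path c x E x"
      unfolding colouring_def by blast+
    then have "colouring c x (u @ v)" "c l = x" "c m = x"
      unfolding colouring_def LE using PE by blast+
    moreover from this have "insert x (c ` label ` set E) \<subseteq> insert x (c ` label ` set (u @ v))"
      unfolding LE by auto
    ultimately show "\<exists>c' x'. colouring c' x' (u @ v) \<and>
        insert x (c ` label ` set E) \<subseteq> span (insert x' (c' ` label ` set (u @ v)))"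
      by (intro embeds_witness)
  qed
qed

text \<open>The orientations are forgotten: each strand occurs in both directions. The set is thus
  closed under reversal, and one argument treats both sides of the move.\<close>

definition triangle_paths :: "nat \<Rightarrow> nat \<Rightarrow> nat \<Rightarrow> bool \<Rightarrow> bool \<Rightarrow> bool \<Rightarrow> visit list set" where
  "triangle_paths a b l sa sb sl =
     (let top = [Visit a True sa, Visit b True sb]; mid = [Visit a False sa, Visit l True sl];
          bot = [Visit b False sb, Visit l False sl]
      in {top, rev top, mid, rev mid, bot, rev bot})"

lemma triangle_paths_rev: "t \<in> triangle_paths a b l sa sb sl \<Longrightarrow> rev t \<in> triangle_paths a b l sa sb sl"
  by (auto simp: triangle_paths_def Let_def)

text \<open>After the third move the middle strand passes over the bottom one with the colour it has on
  the other side of the top strand.\<close>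

lemma path_triangle_rev:
  assumes p: "p \<in> triangle_paths a b l sa sb sl" and dist: "a \<noteq> l" "b \<noteq> l" and ab: "c a = c b"
    and norm: "form (c a) (c a) = 2" "form (c l) (c l) = 2"
    and path: "path c y p z"
  shows "path (c(l := c l \<star> c a)) y (rev p) z"
  using p path dist ab norm act_act[of "c b"] act_distrib[of "c b" y "c l"]
    act_distrib[of "c b" y "c l \<star> c b"]
  by (auto simp: triangle_paths_def Let_def)

text \<open>Each strand enters and leaves the triangle with its old colours, so the pieces outside
  keep theirs and only the crossing \<open>l\<close> is recoloured. The hypotheses are invariant
  under reversing the three strands, so the lemma also yields the inverse move.\<close>

lemma embeds_R3:
  assumes sub: "{p, q, r} \<subseteq> triangle_paths a b l sa sb sl"
    and top: "[Visit a True sa, Visit b True sb] \<in> {p, rev p, q, rev q, r, rev r}"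
    and bot: "l \<in> label ` set (p @ q @ r)"
    and dist: "a \<noteq> l" "b \<noteq> l" and new: "l \<notin> label ` set (u @ v @ w)"
  shows "embeds (p @ u @ q @ v @ r @ w) (rev p @ u @ rev q @ v @ rev r @ w)"
proof (rule embedsI)
  let ?D = "p @ u @ q @ v @ r @ w" and ?E = "rev p @ u @ rev q @ v @ rev r @ w"
  fix c x assume c: "colouring c x ?D"
  define c' where "c' = c(l := c l \<star> c a)"
  have L: "label ` set ?E = label ` set ?D" by simp
  have "Visit a True sa \<in> (\<Union>t\<in>{p, rev p, q, rev q, r, rev r}. set t)"
    using top by (rule UN_I) simp
  then have "Visit a True sa \<in> set ?D" by auto
  then have "label (Visit a True sa) \<in> label ` set ?D" by (rule imageI)
  then have al: "a \<in> label ` set ?D" "l \<in> label ` set ?D"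
    using bot by auto
  then have norm: "form (c a) (c a) = 2" "form (c l) (c l) = 2"
    using c by (auto simp: colouring_def)
  \<comment> \<open>The top strand only passes over, so in either direction it has one colour
    throughout.\<close>
  have ab: "c a = c b"
  proof -
    let ?t = "[Visit a True sa, Visit b True sb]"
    have "\<exists>y z. path c y t z" if "t \<in> {p, q, r}" for t
      using c that unfolding colouring_def path_append by blast
    moreover obtain t where "t \<in> {p, q, r}" "t = ?t \<or> t = rev ?t"
    proof -
      have "?t = t \<or> ?t = rev t \<Longrightarrow> t = ?t \<or> t = rev ?t" for t
        by (metis rev_rev_ident)
      then show ?thesis using top that by blast
    qed
    ultimately obtain y z where "path c y ?t z \<or> path c y (rev ?t) z" by metis
    then show ?thesis by auto
  qed
  have tri: "path c' y (rev t) z" if "t \<in> {p, q, r}" "path c y t z" for t y z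
    unfolding c'_def using path_triangle_rev[OF subsetD[OF sub that(1)] dist ab norm that(2)] .
  have old: "path c' y t z" if "t \<in> {u, v, w}" "path c y t z" for t y z
  proof -
    have "c k = c' k" if "k \<in> label ` set t" for k
      using that \<open>t \<in> {u, v, w}\<close> new by (auto simp: c'_def)
    then show ?thesis using path_cong[of t c c' y z] that(2) by blast
  qed
  obtain y\<^sub>1 y\<^sub>2 y\<^sub>3 y\<^sub>4 y\<^sub>5 where "path c x p y\<^sub>1" "path c y\<^sub>1 u y\<^sub>2" "path c y\<^sub>2 q y\<^sub>3" "path c y\<^sub>3 v y\<^sub>4"
    "path c y\<^sub>4 r y\<^sub>5" "path c y\<^sub>5 w x"
    using c unfolding colouring_def path_append by blast
  then have "path c' x (rev p) y\<^sub>1" "path c' y\<^sub>1 u y\<^sub>2" "path c' y\<^sub>2 (rev q) y\<^sub>3" "path c' y\<^sub>3 v y\<^sub>4"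
    "path c' y\<^sub>4 (rev r) y\<^sub>5" "path c' y\<^sub>5 w x"
    by (simp_all add: tri old)
  then have "path c' x ?E x"
    unfolding path_append by blast
  moreover have "form (c' k) (c' k) = 2" if "k \<in> label ` set ?D" for k
    using that c norm by (auto simp: c'_def colouring_def act_isometry)
  ultimately have "colouring c' x ?E"
    using c unfolding colouring_def L by blast
  moreover have "insert x (c ` label ` set ?D) \<subseteq> span (insert x (c' ` label ` set ?E))"
  proof -
    let ?S = "span (insert x (c' ` label ` set ?E))"
    have base: "c' k \<in> ?S" if "k \<in> label ` set ?D" for k
      using that unfolding L by (intro span_base) blast
    \<comment> \<open>A second half-turn about the top colour recovers the only colour that was
      changed, so no part of the span is lost.\<close>
    have "c l = c' l \<star> c' a" using norm dist by (simp add: c'_def act_act)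
    then have "c l \<in> ?S" using base al by (simp only: act_mem_span)
    then have "c k \<in> ?S" if "k \<in> label ` set ?D" for k
      using base[OF that] by (cases "k = l") (simp_all only: c'_def fun_upd_apply if_False)
    then show ?thesis by (simp add: image_subset_iff span_base)
  qed
  ultimately show "\<exists>c' x'. colouring c' x' ?E \<and>
      insert x (c ` label ` set ?D) \<subseteq> span (insert x' (c' ` label ` set ?E))"
    by blast
qed

end

section \<open>Labels in Gauss codes and invariance of the colour rank\<close>

lemma gauss_code_visit_eq:
  assumes "is_gauss_code D" "v \<in> set D" "w \<in> set D" "label v = label w" "is_over v = is_over w"
  shows "v = w"
proof -
  from assms have "v = w \<or> v = mate w" by (auto simp: is_gauss_code_def)
  moreover have "is_over (mate w) \<longleftrightarrow> \<not> is_over w" by (cases w) simp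
  ultimately show ?thesis using assms(5) by blast
qed

text \<open>A crossing is visited exactly twice, and both visits already lie in \<open>E\<close>.
  Multisets are compared because the moves scatter these visits over the code. This supplies the
  freshness of the labels in the moves.\<close>

lemma gauss_code_label_notin:
  assumes "is_gauss_code D" "mset D = mset (E @ F)" "v \<in> set E" "mate v \<in> set E"
  shows "label v \<notin> label ` set F"
proof
  assume "label v \<in> label ` set F"
  then obtain w where w: "w \<in> set F" "label w = label v" by force
  have D: "distinct D" "set D = set E \<union> set F"
    using assms(1) mset_eq_setD[OF assms(2)] by (auto simp: is_gauss_code_def)
  then have "w = v \<or> w = mate v" using assms(1,3) w by (auto simp: is_gauss_code_def)
  moreover have "set E \<inter> set F = {}"
    using D(1) mset_eq_imp_distinct_iff[OF assms(2)] by auto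
  ultimately show False using assms(3,4) w by auto
qed

context quadratic_space
begin

lemma embeds_reidemeister:
  assumes move: "reidemeister_move D D'" and "is_gauss_code D" "is_gauss_code D'"
  shows "embeds D D' \<and> embeds D' D"
  using assms
proof cases
  case rotate
  then show ?thesis using embeds_rotate by simp
next
  case (rename f)
  then show ?thesis using embeds_rename by simp
next
  case (R1 l b s)
  have "label (Visit l b s) \<notin> label ` set D"
    using R1 assms(3)
    by (intro gauss_code_label_notin[of D' "[Visit l b s, Visit l (\<not> b) s]"]) auto
  then show ?thesis using R1 embeds_R1 by simp
next
  case (R2 p l s m u v)
  let ?E = "[Visit l True s, Visit m True (\<not> s)] @ p"
  have m: "mset D' = mset (?E @ u @ v)" using R2 by simp
  have "label (Visit l True s) \<notin> label ` set (u @ v)"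
    using R2 by (intro gauss_code_label_notin[OF assms(3) m]) auto
  moreover have "label (Visit m True (\<not> s)) \<notin> label ` set (u @ v)"
    using R2 by (intro gauss_code_label_notin[OF assms(3) m]) auto
  ultimately show ?thesis using R2 embeds_R2[of l u v m p s] by simp
next
  case (R3 p q r a b l sa sb sl k u v w)
  let ?t = "[Visit a True sa, Visit b True sb]" and ?m = "[Visit a False sa, Visit l True sl]"
    and ?n = "[Visit b False sb, Visit l False sl]"
  have strands: "{p, q, r} = set (triangle_strands a b l sa sb sl k)"
    using mset_eq_setD[OF R3(3)] by simp
  have sub: "{p, q, r} \<subseteq> triangle_paths a b l sa sb sl"
    unfolding strands by (simp add: triangle_strands_def triangle_paths_def Let_def)
  have "?t \<in> {p, q, r} \<or> rev ?t \<in> {p, q, r}"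
    unfolding strands by (simp add: triangle_strands_def Let_def)
  then have top: "?t \<in> {p, rev p, q, rev q, r, rev r}"
    unfolding insert_iff empty_iff by (metis rev_rev_ident)
  \<comment> \<open>Reversing or permuting the strands does not affect the multiset of their six
    visits, so the triangle may be handled as \<open>?t\<close>, \<open>?m\<close>,
    \<open>?n\<close>.\<close>
  have "mset (concat [p, q, r]) = mset (concat (triangle_strands a b l sa sb sl k))"
    using arg_cong[OF R3(3), of "\<lambda>M. \<Sum>\<^sub># (image_mset mset M)"]
    by (simp add: mset_concat flip: mset_map sum_mset_sum_list)
  also have "\<dots> = mset (?t @ ?m @ ?n)"
    by (simp add: triangle_strands_def Let_def)
  finally have m: "mset (p @ q @ r) = mset (?t @ ?m @ ?n)" by simp
  have d: "distinct (?t @ ?m @ ?n)"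
  proof -
    have "distinct (p @ q @ r)"
      using assms(2) unfolding R3(1) is_gauss_code_def distinct_append set_append by blast
    then show ?thesis using mset_eq_imp_distinct_iff[OF m] by blast
  qed
  have in_D: "set (?t @ ?m @ ?n) \<subseteq> set D" and bot: "l \<in> label ` set (p @ q @ r)"
    using mset_eq_setD[OF m] R3(1) by auto
  have "mset D = mset ((?t @ ?m @ ?n) @ (u @ v @ w))"
    using m R3(1) by simp
  from gauss_code_label_notin[OF assms(2) this, of "Visit l True sl"]
  have new: "l \<notin> label ` set (u @ v @ w)" by auto
  \<comment> \<open>An equality of labels would identify two of the overvisits, against the
    distinctness of the six visits.\<close>
  have dist: "a \<noteq> l" "b \<noteq> l"
    using gauss_code_visit_eq[OF assms(2), of "Visit a True sa" "Visit l True sl"]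
      gauss_code_visit_eq[OF assms(2), of "Visit b True sb" "Visit l True sl"] in_D d by auto
  have sub': "{rev p, rev q, rev r} \<subseteq> triangle_paths a b l sa sb sl"
    using sub triangle_paths_rev by blast
  have top': "?t \<in> {rev p, rev (rev p), rev q, rev (rev q), rev r, rev (rev r)}"
    using top unfolding rev_rev_ident by blast
  have bot': "l \<in> label ` set (rev p @ rev q @ rev r)"
    using bot by simp
  have "embeds D D'"
    unfolding R3(1,2) using embeds_R3[OF sub top bot dist new] .
  moreover have "embeds D' D"
    using embeds_R3[OF sub' top' bot' dist new] unfolding R3(1,2) rev_rev_ident .
  ultimately show ?thesis by blast
qed

text \<open>This transports the rank bound from a diagram with few bridges to an arbitrary diagram
  of the same knot.\<close>

lemma same_knot_colour_rank_le:
  "same_knot D D' \<Longrightarrow> colour_rank_le k D \<longleftrightarrow> colour_rank_le k D'"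
proof (induction rule: same_knot.induct)
  case (move D D')
  then have "embeds D D'" "embeds D' D"
    using embeds_reidemeister by (simp_all add: knot_diagram_def)
  then show ?case using colour_rank_le_embeds by metis
qed auto

end

section \<open>Arcs\<close>

lemma mate_simps [simp]: "label (mate v) = label v" "is_over (mate v) \<longleftrightarrow> \<not> is_over v"
  "mate (mate v) = v"
  by (cases v; simp)+

lemma gauss_code_mate: "is_gauss_code D \<Longrightarrow> v \<in> set D \<Longrightarrow> mate v \<in> set D"
  by (simp add: is_gauss_code_def)

text \<open>Every crossing has exactly one undervisit. Hence the reduction modulo the crossing
  number in \<open>arc_at\<close> only matters after the last undercrossing, where it returns to arc
  \<open>0\<close>.\<close>

lemma crossing_number_eq_undercrossings:
  assumes "is_gauss_code D"
  shows "crossing_number D = length (filter (\<lambda>v. \<not> is_over v) D)"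
proof -
  let ?U = "filter (\<lambda>v. \<not> is_over v) D"
  have "label ` set D \<subseteq> label ` set ?U"
  proof
    fix l assume "l \<in> label ` set D"
    then obtain v where v: "v \<in> set D" "l = label v" by blast
    then have "(if is_over v then mate v else v) \<in> set ?U"
      using gauss_code_mate[OF assms] by simp
    then have "label (if is_over v then mate v else v) \<in> label ` set ?U" by (rule imageI)
    moreover have "label (if is_over v then mate v else v) = l" using v by simp
    ultimately show "l \<in> label ` set ?U" by metis
  qed
  then have "label ` set D = label ` set ?U" by auto
  moreover have "inj_on label (set ?U)"
    using gauss_code_visit_eq[OF assms] by (intro inj_onI) auto
  moreover have "distinct ?U" using assms by (simp add: is_gauss_code_def)
  ultimately show ?thesis
    unfolding crossing_number_def by (metis card_image distinct_card)
qed

lemma gauss_code_over_position: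
  assumes "is_gauss_code D" "v \<in> set D"
  obtains q p where "q < length D" "p < length D" "is_over (D ! q)" "label (D ! q) = label v"
    "D ! q = mate (D ! p)" "\<not> is_over (D ! p)"
proof -
  define w where "w = (if is_over v then v else mate v)"
  have w: "w \<in> set D" "mate w \<in> set D" "is_over w" "label w = label v"
    using assms gauss_code_mate by (auto simp: w_def)
  obtain q p where "q < length D" "D ! q = w" "p < length D" "D ! p = mate w"
    using w(1,2) by (meson in_set_conv_nth)
  with w show ?thesis by (intro that[of q p]) simp_all
qed

lemma crossings_iff:
  "(i, j, k, s) \<in> crossings D \<longleftrightarrow> (\<exists>p q. i = arc_at D q \<and> j = arc_at D p \<and> k = arc_at D (Suc p) \<and>
     s = is_pos (D ! p) \<and> p < length D \<and> q < length D \<and> \<not> is_over (D ! p) \<and> D ! q = mate (D ! p))"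
  unfolding crossings_def by blast

lemma finite_crossings: "finite (crossings D)"
proof (rule finite_subset)
  show "crossings D \<subseteq> (\<lambda>(p, q). (arc_at D q, arc_at D p, arc_at D (Suc p), is_pos (D ! p))) `
      ({..<length D} \<times> {..<length D})"
    unfolding crossings_def by force
qed simp

lemma arc_at_less: "crossing_number D \<ge> 1 \<Longrightarrow> arc_at D p < crossing_number D"
  by (simp add: arc_at_def)

lemma crossings_less:
  assumes "(i, j, k, s) \<in> crossings D" "crossing_number D \<ge> 1"
  shows "i < crossing_number D" "j < crossing_number D" "k < crossing_number D"
  using assms arc_at_less by (auto simp: crossings_iff)

text \<open>The count grows by at most one per entry, so no value is skipped. Applied to
  undervisits, it finds a position on every arc.\<close>

lemma exists_take_filter:
  "k \<le> length (filter P xs) \<Longrightarrow> \<exists>p\<le>length xs. length (filter P (take p xs)) = k"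
proof (induction xs rule: rev_induct)
  case (snoc x xs)
  show ?case
  proof (cases "k \<le> length (filter P xs)")
    case True
    then obtain p where "p \<le> length xs" "length (filter P (take p xs)) = k"
      using snoc.IH by blast
    then show ?thesis by (intro exI[of _ p]) simp
  next
    case False
    with snoc.prems show ?thesis
      by (intro exI[of _ "Suc (length xs)"]) (auto split: if_splits)
  qed
qed simp

context quadratic_space
begin

lemma path_foldl:
  "path c x D y \<Longrightarrow> y = foldl (\<lambda>u v. u \<star> c (label v)) x (filter (\<lambda>v. \<not> is_over v) D)"
  by (induction D arbitrary: x) (auto split: if_splits)

text \<open>The colours of the overstrands span, and they are the colours of the bridges.\<close>

lemma colour_rank_le_bridge_number:
  assumes D: "is_gauss_code D"
  shows "colour_rank_le (bridge_number D) D"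
proof (cases "D = []")
  case True
  then show ?thesis
    unfolding colour_rank_le_def bridge_number_def
    by (auto intro!: exI[of _ "{_}"] span_base)
next
  case False
  show ?thesis
    unfolding colour_rank_le_def
  proof (intro allI impI)
    fix c x assume "colouring c x D"
    then have norm: "\<And>l. l \<in> label ` set D \<Longrightarrow> form (c l) (c l) = 2" and path: "path c x D x"
      unfolding colouring_def by blast+
    let ?under = "\<lambda>v. \<not> is_over v"
    let ?T = "c ` label ` set D"
    \<comment> \<open>\<open>h k\<close> is the colour after \<open>k\<close> undercrossings, that
      is, the colour of arc \<open>k\<close>.\<close>
    define h where "h k = foldl (\<lambda>u v. u \<star> c (label v)) x (take k (filter ?under D))" for k
    have over: "path c x (take q D) (c (label (D ! q)))" if "q < length D" "is_over (D ! q)" for q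
    proof -
      have "path c x (take q D @ D ! q # drop (Suc q) D) x"
        using path that(1) by (simp add: Cons_nth_drop_Suc)
      then obtain y where "path c x (take q D) y" "path c y (D ! q # drop (Suc q) D) x"
        unfolding path_append by blast
      with that(2) show ?thesis by auto
    qed
    have h: "c (label (D ! q)) = h (arc_at D q)" if "q < length D" "is_over (D ! q)" for q
    proof -
      let ?F = "filter ?under (take q D)"
      have F: "filter ?under D = ?F @ filter ?under (drop q D)"
        by (metis append_take_drop_id filter_append)
      then have "c (label (D ! q)) = h (length ?F)"
        using path_foldl[OF over[OF that]] by (simp add: h_def)
      also have "h (length ?F) = h (arc_at D q)"
      \<comment> \<open>Beyond the last undercrossing the strand is on the arc of the base point
        again: the index wraps to \<open>0\<close>, and the colour is \<open>x\<close> because the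
        path closes up.\<close>
      proof (cases "length ?F < crossing_number D")
        case False
        with F have "length ?F = crossing_number D"
          unfolding crossing_number_eq_undercrossings[OF D] by simp
        then have "h (length ?F) = x" "arc_at D q = 0"
          using path_foldl[OF path] crossing_number_eq_undercrossings[OF D]
          by (simp_all add: h_def arc_at_def)
        then show ?thesis by (simp add: h_def)
      qed (simp add: arc_at_def)
      finally show ?thesis .
    qed
    have sub: "?T \<subseteq> h ` fst ` crossings D"
    proof safe
      fix v assume "v \<in> set D"
      then obtain q p where qp: "q < length D" "p < length D" "is_over (D ! q)"
        "label (D ! q) = label v" "D ! q = mate (D ! p)" "\<not> is_over (D ! p)"
        by (rule gauss_code_over_position[OF D])
      then have "(arc_at D q, arc_at D p, arc_at D (Suc p), is_pos (D ! p)) \<in> crossings D"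
        unfolding crossings_iff by blast
      then have "arc_at D q \<in> fst ` crossings D" by force
      with h[of q] qp show "c (label v) \<in> h ` fst ` crossings D" by simp
    qed
    have "card ?T \<le> card (fst ` crossings D)"
      using card_mono[OF _ sub] card_image_le[of "fst ` crossings D" h] finite_crossings
      by (meson finite_imageI le_trans)
    then have card: "card ?T \<le> bridge_number D" using False by (simp add: bridge_number_def)
    have T: "?T \<subseteq> span ?T" by (rule span_superset)
    \<comment> \<open>The start colour is joined by a strand to some overvisit, so it lies in the
      span of the overstrand colours.\<close>
    obtain v where "v \<in> set D" using False by (cases D) auto
    then obtain q where q: "q < length D" "is_over (D ! q)"
      by (metis gauss_code_over_position[OF D])
    have "x \<in> span ?T \<longleftrightarrow> c (label (D ! q)) \<in> span ?T"
    proof (rule path_mem_span_iff[OF over[OF q]])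
      show "form (c l) (c l) = 2" if "l \<in> label ` set (take q D)" for l
        using that norm set_take_subset by fast
      show "c ` label ` set (take q D) \<subseteq> span ?T"
        using T set_take_subset by fast
    qed
    then have "insert x ?T \<subseteq> span ?T" using T q(1) by auto
    then show "\<exists>T. finite T \<and> card T \<le> bridge_number D \<and> insert x (c ` label ` set D) \<subseteq> span T"
      using card by (intro exI[of _ ?T]) simp
  qed
qed

text \<open>This translates a colouring \<open>w\<close> of the arcs into a colouring of the code,
  to which the rank bound applies. Every arc is reached from the base point, so its colour lies in
  the same span.\<close>

lemma arc_colours_rank:
  assumes D: "is_gauss_code D" and n: "crossing_number D \<ge> 1"
    and norm: "\<And>k. k < crossing_number D \<Longrightarrow> form (w k) (w k) = 2"
    and cross: "\<And>i j k s. (i, j, k, s) \<in> crossings D \<Longrightarrow> w k = w j \<star> w i"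
    and rank: "colour_rank_le m D"
  obtains T where "finite T" "card T \<le> m" "w ` {..<crossing_number D} \<subseteq> span T"
proof -
  define over where "over q l \<longleftrightarrow> q < length D \<and> is_over (D ! q) \<and> label (D ! q) = l" for q l
  \<comment> \<open>The overvisit of a crossing is unique, so the choice is harmless:
    \<open>c l\<close> is the colour of the overarc.\<close>
  define c where "c l = w (arc_at D (SOME q. over q l))" for l
  have c: "c l = w (arc_at D q)" if "over q l" for q l
  proof -
    have "over (SOME q. over q l) l" using that by (rule someI)
    then have "D ! (SOME q. over q l) = D ! q"
      using that by (intro gauss_code_visit_eq[OF D]) (auto simp: over_def)
    then have "(SOME q. over q l) = q"
      using D \<open>over (SOME q. over q l) l\<close> that
      by (simp add: over_def is_gauss_code_def nth_eq_iff_index_eq)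
    then show ?thesis by (simp add: c_def)
  qed
  have path: "path c (w 0) (take p D) (w (arc_at D p))" if "p \<le> length D" for p
    using that
  proof (induction p)
    case (Suc p)
    then have p: "p < length D" and IH: "path c (w 0) (take p D) (w (arc_at D p))" by simp_all
    have "path c (w (arc_at D p)) [D ! p] (w (arc_at D (Suc p)))"
    proof (cases "is_over (D ! p)")
      case True
      then have "arc_at D (Suc p) = arc_at D p"
        using p by (simp add: arc_at_def take_Suc_conv_app_nth)
      moreover have "c (label (D ! p)) = w (arc_at D p)"
        using c[of p] p True by (simp add: over_def)
      ultimately show ?thesis using True by simp
    next
      case False
      have "mate (D ! p) \<in> set D"
        using gauss_code_mate[OF D nth_mem[OF p]] .
      then obtain q where q: "q < length D" "D ! q = mate (D ! p)"
        unfolding in_set_conv_nth by blast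
      then have "c (label (D ! p)) = w (arc_at D q)"
        using False by (intro c) (simp add: over_def)
      moreover have "(arc_at D q, arc_at D p, arc_at D (Suc p), is_pos (D ! p)) \<in> crossings D"
        unfolding crossings_iff using p q False by blast
      ultimately show ?thesis using cross False by simp
    qed
    with IH show ?case
      unfolding take_Suc_conv_app_nth[OF p] path_append by blast
  qed (simp add: arc_at_def)
  have normc: "form (c l) (c l) = 2" if l: "l \<in> label ` set D" for l
  proof -
    from l obtain v where "v \<in> set D" "l = label v" by blast
    then obtain q where "over q l"
      using gauss_code_over_position[OF D, of v] unfolding over_def by metis
    from c[OF this] show ?thesis using norm arc_at_less[OF n] by simp
  qed
  have "arc_at D (length D) = 0"
    using crossing_number_eq_undercrossings[OF D] by (simp add: arc_at_def)
  then have "path c (w 0) D (w 0)" using path[of "length D"] by simp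
  then have "colouring c (w 0) D"
    using normc norm[of 0] n by (simp add: colouring_def)
  then obtain T where T: "finite T" "card T \<le> m" "insert (w 0) (c ` label ` set D) \<subseteq> span T"
    using rank unfolding colour_rank_le_def by blast
  have "w k \<in> span T" if "k < crossing_number D" for k
  proof -
    obtain p where p: "p \<le> length D" "length (filter (\<lambda>v. \<not> is_over v) (take p D)) = k"
      using exists_take_filter[of k "\<lambda>v. \<not> is_over v" D] \<open>k < crossing_number D\<close>
      unfolding crossing_number_eq_undercrossings[OF D] by auto
    then have "arc_at D p = k" using that by (simp add: arc_at_def)
    with path[OF p(1)] have *: "path c (w 0) (take p D) (w k)" by simp
    have "w 0 \<in> span T \<longleftrightarrow> w k \<in> span T"
    proof (rule path_mem_span_iff[OF *])
      show "form (c l) (c l) = 2" if "l \<in> label ` set (take p D)" for l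
        using that normc set_take_subset by fast
      show "c ` label ` set (take p D) \<subseteq> span T"
        using T(3) set_take_subset by fast
    qed
    then show ?thesis using T(3) by simp
  qed
  with T(1,2) show ?thesis by (intro that) auto
qed

end

section \<open>Homomorphisms out of a presented group\<close>

context group
begin

definition word_value :: "('g \<Rightarrow> 'a) \<Rightarrow> 'g word \<Rightarrow> 'a" where
  "word_value f w = foldr (\<lambda>(g, e) r. (if e then f g else inv (f g)) \<otimes> r) w \<one>"

lemma word_value_simps [simp]:
  "word_value f [] = \<one>"
  "word_value f ((g, e) # w) = (if e then f g else inv (f g)) \<otimes> word_value f w"
  by (simp_all add: word_value_def)

context
  fixes f :: "'g \<Rightarrow> 'a"
  assumes f: "\<And>g. f g \<in> carrier G"
begin

lemma word_value_closed [simp]: "word_value f w \<in> carrier G"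
  by (induction w) (auto simp: f)

lemma word_value_append: "word_value f (u @ v) = word_value f u \<otimes> word_value f v"
  by (induction u) (auto simp: f m_assoc)

lemma word_value_eq:
  assumes "\<And>r. r \<in> R \<Longrightarrow> word_value f r = \<one>" "word_eq R u v"
  shows "word_value f u = word_value f v"
  using assms(2)
proof induction
  case (cancel u g e v)
  have "word_value f [(g, e), (g, \<not> e)] = \<one>" by (simp add: f)
  then show ?case unfolding word_value_append by simp
qed (simp_all add: word_value_append assms(1))

text \<open>The universal property of a presentation: an assignment that kills the relators extends
  to a homomorphism.\<close>

lemma presented_group_hom:
  assumes rel: "\<And>r. r \<in> R \<Longrightarrow> word_value f r = \<one>"
  obtains \<rho> where "\<rho> \<in> hom (presented_group X R) G"
    "\<And>g. g \<in> X \<Longrightarrow> \<rho> (word_class X R [(g, True)]) = f g"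
proof -
  \<comment> \<open>Any representative will do, since evaluation is constant on word
    classes.\<close>
  define \<rho> where "\<rho> C = word_value f (SOME w. w \<in> C)" for C
  have mem: "u \<in> word_class X R u" if "u \<in> lists (X \<times> UNIV)" for u
    using that by (simp add: word_class_def word_eq.refl)
  have val: "word_value f w = word_value f u" if "w \<in> word_class X R u" for u w
    using that word_value_eq[of R u w, OF rel] by (simp add: word_class_def)
  have \<rho>: "\<rho> C = z" if "u \<in> C" "\<And>w. w \<in> C \<Longrightarrow> word_value f w = z" for C u z
    unfolding \<rho>_def using that by (metis someI)
  have \<rho>_class: "\<rho> (word_class X R u) = word_value f u" if "u \<in> lists (X \<times> UNIV)" for u
    using \<rho>[OF mem[OF that] val] .
  have "\<rho> \<in> hom (presented_group X R) G"
  proof (rule homI)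
    show "\<rho> C \<in> carrier G" for C
      by (simp add: \<rho>_def)
    fix A B assume "A \<in> carrier (presented_group X R)" "B \<in> carrier (presented_group X R)"
    then obtain u v where uv: "u \<in> lists (X \<times> UNIV)" "v \<in> lists (X \<times> UNIV)"
      and A: "A = word_class X R u" and B: "B = word_class X R v"
      by (auto simp: presented_group_def)
    have "\<rho> (\<Union>a\<in>A. \<Union>b\<in>B. word_class X R (a @ b)) = word_value f u \<otimes> word_value f v"
    proof (rule \<rho>)
      have "u @ v \<in> lists (X \<times> UNIV)" using uv by simp
      then show "u @ v \<in> (\<Union>a\<in>A. \<Union>b\<in>B. word_class X R (a @ b))"
        using mem uv unfolding A B by blast
      fix w assume "w \<in> (\<Union>a\<in>A. \<Union>b\<in>B. word_class X R (a @ b))"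
      then obtain a b where "a \<in> A" "b \<in> B" "w \<in> word_class X R (a @ b)" by blast
      then show "word_value f w = word_value f u \<otimes> word_value f v"
        using val A B by (simp add: word_value_append)
    qed
    then show "\<rho> (A \<otimes>\<^bsub>presented_group X R\<^esub> B) = \<rho> A \<otimes> \<rho> B"
      using uv by (simp add: presented_group_def A B \<rho>_class)
  qed
  moreover have "\<rho> (word_class X R [(g, True)]) = f g" if "g \<in> X" for g
    using that f by (simp add: \<rho>_class)
  ultimately show ?thesis by (rule that)
qed

end

end

section \<open>Trace-free matrices\<close>

interpretation SL2: group SL2
proof (rule groupI)
  fix A assume "A \<in> carrier SL2"
  then have det: "det A = 1" by (simp add: SL2_def)
  then obtain B where B: "A ** B = mat 1" "B ** A = mat 1"
    using invertible_det_nz[of A] by (auto simp: invertible_def)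
  have "det A * det B = 1" using B(1) by (metis det_I det_mul)
  then show "\<exists>B\<in>carrier SL2. B \<otimes>\<^bsub>SL2\<^esub> A = \<one>\<^bsub>SL2\<^esub>"
    using det B by (intro bexI[of _ B]) (simp_all add: SL2_def)
qed (simp_all add: SL2_def det_mul matrix_mul_assoc)

text \<open>This scaling turns vectors of norm 2 into matrices of determinant 1 and the dot product
  into minus the trace of the product.\<close>

definition inv_sqrt_2 :: complex where
  "inv_sqrt_2 = csqrt (1 / 2)"

lemma inv_sqrt_2_mult: "inv_sqrt_2 * inv_sqrt_2 = 1 / 2" "inv_sqrt_2 * (inv_sqrt_2 * z) = z / 2"
proof -
  show *: "inv_sqrt_2 * inv_sqrt_2 = 1 / 2"
    unfolding power2_eq_square[symmetric] inv_sqrt_2_def by (rule power2_csqrt)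
  show "inv_sqrt_2 * (inv_sqrt_2 * z) = z / 2"
    unfolding mult.assoc[symmetric] * by simp
qed

text \<open>The matrix \<open>i u\<^sub>0 \<sigma>\<^sub>z + i u\<^sub>1 \<sigma>\<^sub>x + i u\<^sub>2 \<sigma>\<^sub>y\<close> in terms of the Pauli matrices, divided by
  the square root of 2.\<close>

definition pauli :: "(nat \<Rightarrow> complex) \<Rightarrow> complex^2^2" where
  "pauli u = (let h = inv_sqrt_2 in
     vector [vector [\<i> * h * u 0, \<i> * h * u 1 + h * u 2],
             vector [\<i> * h * u 1 - h * u 2, - (\<i> * h * u 0)]])"

lemma pauli_nth:
  "pauli u $ 1 $ 1 = \<i> * inv_sqrt_2 * u 0" "pauli u $ 2 $ 2 = - (\<i> * inv_sqrt_2 * u 0)"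
  "pauli u $ 1 $ 2 = inv_sqrt_2 * (\<i> * u 1 + u 2)"
  "pauli u $ 2 $ 1 = inv_sqrt_2 * (\<i> * u 1 - u 2)"
  by (simp_all add: pauli_def Let_def algebra_simps)

lemma sum_3: "(\<Sum>k<3. g k) = g 0 + g 1 + (g (2::nat) :: complex)"
  by (simp add: numeral_3_eq_3 numeral_2_eq_2)

lemma trace_pauli: "trace (pauli u) = 0"
  by (simp add: trace_def sum_2 pauli_nth)

lemma det_pauli: "det (pauli u) = (\<Sum>k<3. u k * u k) / 2"
  unfolding det_2 pauli_nth sum_3 by (simp add: algebra_simps inv_sqrt_2_mult)

lemma trace_pauli_mult: "trace (pauli u ** pauli v) = - (\<Sum>k<3. u k * v k)"
  unfolding trace_def sum_2 matrix_matrix_mult_def sum_3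
  by (simp add: sum_2 pauli_nth algebra_simps inv_sqrt_2_mult)

lemma pauli_anticommute: "pauli u ** pauli v + pauli v ** pauli u = mat (- (\<Sum>k<3. u k * v k))"
  unfolding vec_eq_iff forall_2 matrix_matrix_mult_def sum_3
  by (simp add: sum_2 pauli_nth mat_def algebra_simps inv_sqrt_2_mult)

lemma pauli_square: "pauli u ** pauli u = mat (- (\<Sum>k<3. u k * u k) / 2)"
  unfolding vec_eq_iff forall_2 matrix_matrix_mult_def sum_3
  by (simp add: sum_2 pauli_nth mat_def algebra_simps inv_sqrt_2_mult)

text \<open>Write \<open>A\<close>, \<open>B\<close> for the two matrices and \<open>d\<close> for
  the dot product. The Clifford relations \<open>AB + BA = -d\<close> and \<open>AA = -1\<close>
  give \<open>ABA = (AB + BA)A - B(AA) = -dA + B\<close>. As the inverse of \<open>A\<close> is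
  \<open>-A\<close>, conjugation by \<open>A\<close> is the half-turn.\<close>

lemma pauli_conjugate:
  assumes "(\<Sum>k<3. u k * u k) = 2"
  shows "pauli u ** pauli v ** pauli u = - pauli (\<lambda>k. (\<Sum>k<3. u k * v k) * u k - v k)"
proof -
  let ?A = "pauli u" and ?B = "pauli v" and ?d = "\<Sum>k<3. u k * v k"
  have "?A ** ?B ** ?A + ?B ** (?A ** ?A) = (?A ** ?B + ?B ** ?A) ** ?A"
    unfolding matrix_mul_assoc
    by (simp add: vec_eq_iff matrix_matrix_mult_def algebra_simps sum.distrib)
  then have "?A ** ?B ** ?A = mat (- ?d) ** ?A - ?B ** mat (- 1)"
    unfolding pauli_anticommute pauli_square assms by (simp add: eq_diff_eq)
  also have "\<dots> = - pauli (\<lambda>k. ?d * u k - v k)"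
    unfolding vec_eq_iff forall_2 matrix_matrix_mult_def
    by (simp add: sum_2 pauli_nth mat_def algebra_simps)
  finally show ?thesis .
qed

lemma matrix_neg_mult: "(- A) ** B = - (A ** B)" "A ** (- B) = - (A ** B)"
  for A B :: "complex^2^2"
  by (simp_all add: vec_eq_iff matrix_matrix_mult_def sum_negf)

lemma pauli_mem_SL2: "(\<Sum>k<3. u k * u k) = 2 \<Longrightarrow> pauli u \<in> carrier SL2"
  by (simp add: SL2_def det_pauli)

lemma inv_pauli:
  assumes "(\<Sum>k<3. u k * u k) = 2"
  shows "inv\<^bsub>SL2\<^esub> (pauli u) = - pauli u"
proof (rule SL2.inv_equality)
  show "- pauli u \<otimes>\<^bsub>SL2\<^esub> pauli u = \<one>\<^bsub>SL2\<^esub>"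
    by (simp add: SL2_def matrix_neg_mult pauli_square assms)
      (simp add: vec_eq_iff mat_def)
  show "- pauli u \<in> carrier SL2"
    using det_pauli[of u] assms by (simp add: SL2_def det_2)
qed (rule pauli_mem_SL2[OF assms])

text \<open>Vectors in dimension 3 with Gram matrix \<open>x\<close> become the images of the
  meridians; the crossing relations of the vectors make the relators trivial. The triple coordinates
  are whatever this representation gives.\<close>

lemma lift_to_trace_free_slice:
  fixes D :: gauss_code and u :: "nat \<Rightarrow> nat \<Rightarrow> complex"
  defines "n \<equiv> crossing_number D"
  assumes \<nu>: "\<And>i j k s. (i, j, k, s) \<in> crossings D \<Longrightarrow> {\<nu> i, \<nu> j, \<nu> k} \<subseteq> {1..n}"
    and gram: "\<And>i j. i \<in> {1..n} \<Longrightarrow> j \<in> {1..n} \<Longrightarrow> (\<Sum>k<3. u i k * u j k) = coord x i j"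
    and cross: "\<And>i j k s. (i, j, k, s) \<in> crossings D \<Longrightarrow>
      u (\<nu> k) = (\<lambda>m. coord x (\<nu> i) (\<nu> j) * u (\<nu> i) m - u (\<nu> j) m)"
    and x: "x \<in> index_pairs n \<rightarrow>\<^sub>E UNIV"
  shows "\<exists>s\<in>trace_free_slice D \<nu>. slice_projection s = x"
proof -
  \<comment> \<open>Evaluation of words expects a value in the group for every generator name, hence
    the identity outside the range.\<close>
  define f where "f i = (if i \<in> {1..n} then pauli (u i) else mat 1)" for i
  let ?X = "{1..n}" and ?R = "wirtinger_relators D \<nu>"
  have norm: "(\<Sum>k<3. u i k * u i k) = 2" if "i \<in> {1..n}" for i
    using gram[OF that that] by (simp add: coord_def)
  have f: "f i \<in> carrier SL2" for i
    using pauli_mem_SL2[OF norm] by (auto simp: f_def SL2_def)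
  have rel: "SL2.word_value f r = \<one>\<^bsub>SL2\<^esub>" if r_mem: "r \<in> ?R" for r
  proof -
    obtain i j k s where r: "r = [(\<nu> k, False), (\<nu> i, \<not> s), (\<nu> j, True), (\<nu> i, s)]"
      and c: "(i, j, k, s) \<in> crossings D"
      using r_mem unfolding wirtinger_relators_def by blast
    have mem: "\<nu> i \<in> {1..n}" "\<nu> j \<in> {1..n}" "\<nu> k \<in> {1..n}" using \<nu>[OF c] by simp_all
    let ?A = "pauli (u (\<nu> i))" and ?B = "pauli (u (\<nu> j))" and ?C = "pauli (u (\<nu> k))"
    have fA: "f (\<nu> i) = ?A" "f (\<nu> j) = ?B" "f (\<nu> k) = ?C"
      using mem by (simp_all add: f_def)
    have ABA: "?A ** ?B ** ?A = - ?C"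
      using pauli_conjugate[OF norm[OF mem(1)], of "u (\<nu> j)"] gram[OF mem(1,2)] cross[OF c] by simp
    \<comment> \<open>For either sign \<open>s\<close> exactly one of the two letters of the overarc
      is inverted. Inversion is negation here, so this minus sign cancels the one from the inverse
      of \<open>?C\<close>.\<close>
    have "SL2.word_value f r = ?C ** (?A ** ?B ** ?A)"
      unfolding r using mem
      by (cases s) (simp_all add: fA inv_pauli[OF norm], simp_all add: SL2_def matrix_neg_mult matrix_mul_assoc)
    also have "\<dots> = \<one>\<^bsub>SL2\<^esub>"
      unfolding ABA by (simp add: SL2_def matrix_neg_mult pauli_square norm[OF mem(3)])
        (simp add: vec_eq_iff mat_def)
    finally show ?thesis .
  qed
  obtain \<rho> where hom: "\<rho> \<in> hom (presented_group ?X ?R) SL2"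
    and \<rho>: "\<And>i. i \<in> ?X \<Longrightarrow> \<rho> (word_class ?X ?R [(i, True)]) = f i"
    using SL2.presented_group_hom[of f ?R ?X, OF f rel] by metis
  have G: "knot_group D \<nu> = presented_group ?X ?R"
    by (simp add: knot_group_def n_def)
  have m: "meridian D \<nu> i = word_class ?X ?R [(i, True)]" for i
    by (simp add: meridian_def n_def)
  have \<rho>m: "\<rho> (meridian D \<nu> i) = pauli (u i)" if "i \<in> ?X" for i
    using \<rho>[OF that] that by (simp add: m f_def)
  have carrier: "meridian D \<nu> i \<in> carrier (knot_group D \<nu>)" if "i \<in> ?X" for i
    using that unfolding G m by (auto simp: presented_group_def)
  have "\<rho> \<in> trace_free_reps D \<nu>"
    using hom \<rho>m by (simp add: trace_free_reps_def G trace_pauli flip: n_def)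
  moreover have "(\<lambda>(i, j)\<in>index_pairs n.
      - trace (\<rho> (meridian D \<nu> i \<otimes>\<^bsub>knot_group D \<nu>\<^esub> meridian D \<nu> j))) = x"
  proof (rule extensionalityI)
    show "x \<in> extensional (index_pairs n)" using x by (simp add: PiE_def)
    fix ij assume ij: "ij \<in> index_pairs n"
    then obtain i j where p: "ij = (i, j)" "i \<in> ?X" "j \<in> ?X" "i < j"
      by (auto simp: index_pairs_def)
    have "\<rho> (meridian D \<nu> i \<otimes>\<^bsub>knot_group D \<nu>\<^esub> meridian D \<nu> j) = pauli (u i) ** pauli (u j)"
      using hom_mult[OF hom[folded G] carrier carrier, of i j] p \<rho>m by (simp add: SL2_def)
    then show "(\<lambda>(i, j)\<in>index_pairs n.
        - trace (\<rho> (meridian D \<nu> i \<otimes>\<^bsub>knot_group D \<nu>\<^esub> meridian D \<nu> j))) ij = x ij"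
      using ij p gram[OF p(2,3)] by (simp add: trace_pauli_mult coord_def)
  qed simp
  ultimately show ?thesis
    unfolding trace_free_slice_def Let_def slice_projection_def n_def[symmetric]
    by (auto intro!: bexI)
qed

section \<open>Lifting\<close>

lemma vector_space_fun: "vector_space (\<lambda>a (f :: nat \<Rightarrow> complex) k. a * f k)"
  by unfold_locales (auto simp: fun_eq_iff algebra_simps)

lemma quadratic_space_gram:
  fixes g :: "nat \<Rightarrow> nat \<Rightarrow> complex"
  assumes "\<And>i j. g i j = g j i"
  shows "quadratic_space (\<lambda>a (f :: nat \<Rightarrow> complex) k. a * f k)
    (\<lambda>v w. \<Sum>i\<in>I. \<Sum>j\<in>I. v i * w j * g i j)"
proof (intro quadratic_space.intro vector_space_fun quadratic_space_axioms.intro)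
  show "(\<Sum>i\<in>I. \<Sum>j\<in>I. v i * w j * g i j) = (\<Sum>i\<in>I. \<Sum>j\<in>I. w i * v j * g i j)" for v w
    by (subst sum.swap) (simp add: assms mult.commute)
qed (simp_all add: algebra_simps sum.distrib sum_distrib_left)

lemma quadratic_space_dot:
  "quadratic_space (\<lambda>a (f :: nat \<Rightarrow> complex) k. a * f k) (\<lambda>v w. \<Sum>k<m. v k * w k)"
  by (intro quadratic_space.intro vector_space_fun quadratic_space_axioms.intro)
    (simp_all add: algebra_simps sum.distrib sum_distrib_left)

lemma coord_sym: "coord x i j = coord x j i"
  by (simp add: coord_def)

text \<open>The coordinates of the standard basis of the free vector space with Gram matrix \<open>g\<close>.\<close>

lemma gram_realization:
  assumes "\<And>i j. g i j = g j i" "finite I"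
  obtains y :: "nat \<Rightarrow> nat \<Rightarrow> complex" and m where
    "\<forall>i\<in>I. \<forall>j\<in>I. (\<Sum>k<m. y i k * y j k) = g i j"
    "\<forall>i\<in>I. \<forall>j\<in>I. \<forall>k\<in>I. \<forall>a. (\<forall>l\<in>I. g l k = a * g l i - g l j) \<longrightarrow>
       y k = (\<lambda>m. a * y i m - y j m)"
proof -
  let ?s = "\<lambda>a (f :: nat \<Rightarrow> complex) k. a * f k"
  let ?b = "\<lambda>v w. \<Sum>i\<in>I. \<Sum>j\<in>I. v i * w j * g i j"
  interpret quadratic_space ?s ?b by (rule quadratic_space_gram) fact
  define e :: "nat \<Rightarrow> nat \<Rightarrow> complex" where "e i = (\<lambda>j. if i = j then 1 else 0)" for i
  obtain \<phi> where *: "(\<forall>k u v. \<phi> k (u + v) = \<phi> k u + \<phi> k v) \<and> (\<forall>k a u. \<phi> k (?s a u) = a * \<phi> k u)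
    \<and> (\<forall>u\<in>span (e ` I). \<forall>v\<in>span (e ` I). ?b u v = (\<Sum>k<card I. \<phi> k u * \<phi> k v))
    \<and> (\<forall>u. (\<forall>v. ?b u v = 0) \<longrightarrow> (\<forall>k. \<phi> k u = 0))"
    using exists_orthonormal_coordinates[OF quadratic_space_axioms finite_imageI[OF assms(2)]
      card_image_le[OF assms(2)]] by (rule exE)
  then have add: "\<phi> k (u + v) = \<phi> k u + \<phi> k v" and sc: "\<phi> k (?s a u) = a * \<phi> k u"
    and gram: "u \<in> span (e ` I) \<Longrightarrow> v \<in> span (e ` I) \<Longrightarrow> ?b u v = (\<Sum>k<card I. \<phi> k u * \<phi> k v)"
    and rad: "(\<And>v. ?b u v = 0) \<Longrightarrow> \<phi> k u = 0" for k a u v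
    by blast+
  have be: "?b (e i) w = (\<Sum>j\<in>I. w j * g i j)" if "i \<in> I" for i w
  proof -
    have "?b (e i) w = (\<Sum>l\<in>I. if l = i then \<Sum>j\<in>I. w j * g i j else 0)"
      by (intro sum.cong) (auto simp: e_def)
    then show ?thesis using that assms(2) by simp
  qed
  have bee: "?b (e i) (e j) = g i j" if "i \<in> I" "j \<in> I" for i j
  proof -
    have "?b (e i) (e j) = (\<Sum>l\<in>I. if l = j then g i j else 0)"
      unfolding be[OF that(1)] by (intro sum.cong) (auto simp: e_def)
    then show ?thesis using that(2) assms(2) by simp
  qed
  show ?thesis
  proof (rule that[of "\<lambda>i k. \<phi> k (e i)" "card I"])
    show "\<forall>i\<in>I. \<forall>j\<in>I. (\<Sum>k<card I. \<phi> k (e i) * \<phi> k (e j)) = g i j"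
    proof (intro ballI)
      fix i j assume ij: "i \<in> I" "j \<in> I"
      have "e i \<in> span (e ` I)" "e j \<in> span (e ` I)"
        using ij by (simp_all add: span_base)
      then have "?b (e i) (e j) = (\<Sum>k<card I. \<phi> k (e i) * \<phi> k (e j))"
        by (rule gram)
      then show "(\<Sum>k<card I. \<phi> k (e i) * \<phi> k (e j)) = g i j" using bee[OF ij] by simp
    qed
    show "\<forall>i\<in>I. \<forall>j\<in>I. \<forall>k\<in>I. \<forall>a. (\<forall>l\<in>I. g l k = a * g l i - g l j) \<longrightarrow>
       (\<lambda>m. \<phi> m (e k)) = (\<lambda>m. a * \<phi> m (e i) - \<phi> m (e j))"
    proof (intro ballI allI impI)
    fix i j k a assume ijk: "i \<in> I" "j \<in> I" "k \<in> I" and rel: "\<forall>l\<in>I. g l k = a * g l i - g l j"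
    \<comment> \<open>The defect of the relation is orthogonal to everything, so it lies in the
      radical and \<open>\<phi>\<close> kills it.\<close>
    let ?r = "e k + (?s (- a) (e i) + e j)"
    have "?b ?r v = 0" for v
    proof -
      have "?b ?r v = (\<Sum>l\<in>I. v l * g k l) - a * (\<Sum>l\<in>I. v l * g i l) + (\<Sum>l\<in>I. v l * g j l)"
        unfolding form_add form_scale using ijk by (simp add: be)
      also have "\<dots> = (\<Sum>l\<in>I. v l * (g k l - a * g i l + g j l))"
        by (simp add: algebra_simps sum.distrib sum_subtractf sum_distrib_left)
      also have "\<dots> = 0"
      proof (intro sum.neutral ballI)
        fix l assume "l \<in> I"
        then have "g k l - a * g i l + g j l = 0"
          using bspec[OF rel, of l] assms(1)[of k l] assms(1)[of i l] assms(1)[of j l] by simp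
        then show "v l * (g k l - a * g i l + g j l) = 0" by simp
      qed
      finally show ?thesis .
    qed
    then have "\<phi> m ?r = 0" for m by (rule rad)
    moreover have "\<phi> m ?r = \<phi> m (e k) - a * \<phi> m (e i) + \<phi> m (e j)" for m
      unfolding add sc by simp
    ultimately show "(\<lambda>m. \<phi> m (e k)) = (\<lambda>m. a * \<phi> m (e i) - \<phi> m (e j))"
      by (simp add: fun_eq_iff eq_diff_eq add_eq_0_iff2 diff_add_eq)
    qed
  qed
qed

lemma same_knot_diagram: "same_knot D D' \<Longrightarrow> knot_diagram D \<and> knot_diagram D'"
  by (induction rule: same_knot.induct) auto

text \<open>Coordinates are chosen twice. The first choice realises \<open>x\<close> by vectors
  \<open>y\<close> that satisfy the crossing relations exactly, in some dimension \<open>m\<close>.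
  The bridge bound then puts them into the span of at most three vectors, and the second choice
  moves them linearly and isometrically to dimension 3.\<close>

lemma fundamental_variety_lifts:
  assumes same: "same_knot D D\<^sub>0" and b: "bridge_number D\<^sub>0 < 4"
    and n: "crossing_number D \<ge> 1" and \<nu>: "arc_numbering D \<nu>"
    and x: "x \<in> fundamental_variety D \<nu>"
  shows "\<exists>s\<in>trace_free_slice D \<nu>. slice_projection s = x"
proof -
  let ?n = "crossing_number D"
  have gc: "is_gauss_code D" "is_gauss_code D\<^sub>0"
    using same_knot_diagram[OF same] by (simp_all add: knot_diagram_def)
  have \<nu>_mem: "\<nu> k \<in> {1..?n}" if "k < ?n" for k
    using \<nu> that bij_betwE unfolding arc_numbering_def by blast
  have \<nu>_crossing: "{\<nu> i, \<nu> j, \<nu> k} \<subseteq> {1..?n}" if "(i, j, k, s) \<in> crossings D" for i j k s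
    using \<nu>_mem crossings_less[OF that n] by simp
  obtain y :: "nat \<Rightarrow> nat \<Rightarrow> complex" and m
    where gram': "\<forall>i\<in>{1..?n}. \<forall>j\<in>{1..?n}. (\<Sum>k<m. y i k * y j k) = coord x i j"
      and lin: "\<forall>i\<in>{1..?n}. \<forall>j\<in>{1..?n}. \<forall>k\<in>{1..?n}. \<forall>a.
        (\<forall>l\<in>{1..?n}. coord x l k = a * coord x l i - coord x l j) \<longrightarrow> y k = (\<lambda>m. a * y i m - y j m)"
    by (rule gram_realization[of "coord x" "{1..?n}", OF coord_sym finite_atLeastAtMost])
  have gram: "(\<Sum>k<m. y i k * y j k) = coord x i j" if "i \<in> {1..?n}" "j \<in> {1..?n}" for i j
    using gram' that by blast
  let ?s = "\<lambda>a (f :: nat \<Rightarrow> complex) k. a * f k"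
  let ?b = "\<lambda>v w :: nat \<Rightarrow> complex. \<Sum>k<m. v k * w k"
  interpret quadratic_space ?s ?b by (rule quadratic_space_dot)
  have norm: "?b (y i) (y i) = 2" if "i \<in> {1..?n}" for i
    using gram[OF that that] by (simp add: coord_def)
  have act: "act (y j) (y i) = (\<lambda>m. coord x i j * y i m - y j m)"
    if "i \<in> {1..?n}" "j \<in> {1..?n}" for i j
    using gram[OF that(2,1)] coord_sym[of x i j] by (simp add: act_def fun_eq_iff)
  have cross: "y (\<nu> k) = act (y (\<nu> j)) (y (\<nu> i))" if c: "(i, j, k, s) \<in> crossings D" for i j k s
  proof -
    \<comment> \<open>Wirtinger triples order the underarcs by number, not by orientation. Since the
      half-turn is an involution, the relation can be read in either direction.\<close>
    let ?j = "min (\<nu> j) (\<nu> k)" and ?k = "max (\<nu> j) (\<nu> k)"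
    have mem: "\<nu> i \<in> {1..?n}" "?j \<in> {1..?n}" "?k \<in> {1..?n}"
      using \<nu>_crossing[OF c] by (auto simp: min_def max_def)
    have "(\<nu> i, ?j, ?k) \<in> wirtinger_triples D \<nu>"
      using c unfolding wirtinger_triples_def by blast
    then have "\<forall>l\<in>{1..?n}. coord x l ?k = coord x (\<nu> i) ?j * coord x l (\<nu> i) - coord x l ?j"
      using x unfolding fundamental_variety_def by blast
    then have "y ?k = (\<lambda>m. coord x (\<nu> i) ?j * y (\<nu> i) m - y ?j m)"
      using lin mem by blast
    then have "y ?k = act (y ?j) (y (\<nu> i))"
      using act[OF mem(1,2)] by simp
    moreover have "act (y ?k) (y (\<nu> i)) = y ?j"
      unfolding calculation by (intro act_act norm mem)
    ultimately show ?thesis by (cases "\<nu> j \<le> \<nu> k") (simp_all add: min_def max_def)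
  qed
  have rank: "colour_rank_le (bridge_number D\<^sub>0) D"
    unfolding same_knot_colour_rank_le[OF same] by (rule colour_rank_le_bridge_number[OF gc(2)])
  obtain T where T: "finite T" "card T \<le> bridge_number D\<^sub>0"
    and sub: "(\<lambda>k. y (\<nu> k)) ` {..<?n} \<subseteq> span T"
    by (rule arc_colours_rank[where w = "\<lambda>k. y (\<nu> k)", OF gc(1) n norm[OF \<nu>_mem] cross rank])
  have T3: "card T \<le> 3" using T(2) b by simp
  have y_span: "y i \<in> span T" if i: "i \<in> {1..?n}" for i
  proof -
    have "\<nu> ` {..<?n} = {1..?n}" using \<nu> by (simp add: arc_numbering_def bij_betw_def)
    with i have "i \<in> \<nu> ` {..<?n}" by simp
    then show ?thesis using sub by auto
  qed
  obtain \<phi> :: "nat \<Rightarrow> _" where "(\<forall>k u v. \<phi> k (u + v) = \<phi> k u + \<phi> k v) \<and> (\<forall>k a u. \<phi> k (?s a u) = a * \<phi> k u)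
    \<and> (\<forall>u\<in>span T. \<forall>v\<in>span T. ?b u v = (\<Sum>k<3. \<phi> k u * \<phi> k v))
    \<and> (\<forall>u. (\<forall>v. ?b u v = 0) \<longrightarrow> (\<forall>k. \<phi> k u = 0))"
    using exists_orthonormal_coordinates[OF quadratic_space_axioms T(1) T3] by (rule exE)
  then have add: "\<phi> k (u + v) = \<phi> k u + \<phi> k v" and sc: "\<phi> k (?s a u) = a * \<phi> k u"
    and dot: "u \<in> span T \<Longrightarrow> v \<in> span T \<Longrightarrow> ?b u v = (\<Sum>k<3. \<phi> k u * \<phi> k v)" for k a u v
    by blast+
  show ?thesis
  proof (rule lift_to_trace_free_slice[where u = "\<lambda>i k. \<phi> k (y i)"])
    show "(\<Sum>k<3. \<phi> k (y i) * \<phi> k (y j)) = coord x i j"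
      if "i \<in> {1..?n}" "j \<in> {1..?n}" for i j
    proof -
      have "?b (y i) (y j) = (\<Sum>k<3. \<phi> k (y i) * \<phi> k (y j))"
        using that by (intro dot y_span)
      then show ?thesis using gram[OF that] by simp
    qed
    show "x \<in> index_pairs ?n \<rightarrow>\<^sub>E UNIV"
      using x unfolding fundamental_variety_def by blast
    fix i j k s assume c: "(i, j, k, s) \<in> crossings D"
    show "{\<nu> i, \<nu> j, \<nu> k} \<subseteq> {1..?n}" by (rule \<nu>_crossing[OF c])
    \<comment> \<open>The relation is written without subtraction so that additivity and homogeneity
      of \<open>\<phi>\<close> apply directly.\<close>
    have "y (\<nu> k) + y (\<nu> j) = ?s (coord x (\<nu> i) (\<nu> j)) (y (\<nu> i))"
      using cross[OF c] act \<nu>_crossing[OF c] by (simp add: fun_eq_iff)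
    then have "\<phi> l (y (\<nu> k)) + \<phi> l (y (\<nu> j)) = coord x (\<nu> i) (\<nu> j) * \<phi> l (y (\<nu> i))" for l
      by (metis add sc)
    then show "(\<lambda>l. \<phi> l (y (\<nu> k))) = (\<lambda>l. coord x (\<nu> i) (\<nu> j) * \<phi> l (y (\<nu> i)) - \<phi> l (y (\<nu> j)))"
      by (simp add: fun_eq_iff eq_diff_eq)
  qed
qed

theorem theorem4p8:
  fixes K :: "gauss_code set" and D :: gauss_code and \<nu> :: "nat \<Rightarrow> nat"
  assumes "K \<in> knots"
    and "bridge_index K < 4"
    and "D \<in> K"
    and "crossing_number D \<ge> 1"
    and "arc_numbering D \<nu>"
  shows "ghost_characters D \<nu> = {} \<and>
    (\<forall>x \<in> fundamental_variety D \<nu>. \<exists>s \<in> trace_free_slice D \<nu>. slice_projection s = x)"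
proof -
  \<comment> \<open>An infimum of a nonempty set of natural numbers is attained, so some diagram of
    \<open>K\<close> has at most three bridges.\<close>
  have "bridge_index K \<in> bridge_number ` K"
    unfolding bridge_index_def using assms(3) by (intro Inf_nat_def1) blast
  then obtain D\<^sub>0 where D\<^sub>0: "D\<^sub>0 \<in> K" "bridge_number D\<^sub>0 < 4"
    using assms(2) by force
  obtain D\<^sub>1 where "K = {(D, D'). same_knot D D'} `` {D\<^sub>1}"
    using assms(1) unfolding knots_def by (rule quotientE)
  then have "same_knot D D\<^sub>0"
    using assms(3) D\<^sub>0(1) same_knot.sym same_knot.trans by blast
  then have lifts: "\<forall>x \<in> fundamental_variety D \<nu>. \<exists>s \<in> trace_free_slice D \<nu>. slice_projection s = x"
    using fundamental_variety_lifts D\<^sub>0(2) assms(4,5) by blast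
  then have "fundamental_variety D \<nu> \<subseteq> slice_projection ` trace_free_slice D \<nu>"
    by force
  with lifts show ?thesis unfolding ghost_characters_def by blast
qed

end
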